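(* Let $d\geq 1$ and let $(F_n)$ be a Følner sequence of $\mathbb{Z}^d$. For every $n$, let $Y_n$ denote a uniformly chosen element of $F_n$. Assume that the sequence of distributions of the $\mathbb{N}$-valued random variables $\gcd(Y_n)$ is tight (which implies $d\geq 2$). Then $\mu_{F_n,\mathsf{gcd}}$ converges weakly to $\mu_{\infty,\mathsf{gcd}}$ on $\Omega_{\mathbb{N}}$.
   Context: $\mathbb{N}=\{0,1,2,\dots\}$, with the discrete topology. A sequence $(F_n)$ of finite nonempty subsets of $\mathbb{Z}^d$ is a Følner sequence if for every $y\in\mathbb{Z}^d$, $|F_n\Delta(F_n+y)|=o(|F_n|)$. For $x\in\mathbb{Z}^d$, $\gcd(x):=\gcd(x_1,\dots,x_d)$, with $\gcd(0,\dots,0)=0$. $\Omega_{\mathbb{N}}:=\mathbb{N}^{\mathbb{Z}^d}$ with the product topology; probability measures on it carry the weak topology. For a nonempty finite $F\subset\mathbb{Z}^d$, $\mu_{F,\mathsf{gcd}}$ is the distribution of the random element $x\mapsto\gcd(x+Y)$ of $\Omega_{\mathbb{N}}$, where $Y$ is uniformly distributed in $F$. Definition of $\mu_{\infty,\mathsf{gcd}}$: independently for every prime $p$, set $\mathcal{W}_0^p:=\mathbb{Z}^d$ and, for each $n\ge 1$, conditionally on $(\mathcal{W}_0^p,\dots,\mathcal{W}_{n-1}^p)$, pick $\mathcal{W}_n^p$ uniformly among the cosets of $p^n\mathbb{Z}^d$ lying inside $\mathcal{W}_{n-1}^p$. For $x\in\mathbb{Z}^d$ let $V_p(x):=\sup\{n\in\mathbb{N}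 : x\in\mathcal{W}_n^p\}\in\mathbb{N}\cup\{\infty\}$. Then $\mu_{\infty,\mathsf{gcd}}$ is the distribution of the random map $x\mapsto\prod_{p\text{ prime}}p^{V_p(x)}$ (with the convention that the product is $0$ if $V_p(x)=\infty$ for all $p$). It is a priori a distribution on $(\mathbb{N}\cup\{\infty\})^{\mathbb{Z}^d}$; for $d\ge2$, by Borel--Cantelli all values are almost surely finite and it is regarded as a probability measure on $\Omega_{\mathbb{N}}$. *)

theory Defs
  imports "HOL-Probability.Probability" "HOL-Library.Landau_Symbols"
    "HOL-Computational_Algebra.Primes"
begin

definition folner :: "(nat \<Rightarrow> (int ^ 'd) set) \<Rightarrow> bool" where
  "folner F \<longleftrightarrow>
     (\<forall>n. finite (F n) \<and> F n \<noteq> {}) \<and>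
     (\<forall>y. (\<lambda>n. real (card (sym_diff (F n) ((\<lambda>x. x + y) ` F n)))) \<in> o(\<lambda>n. real (card (F n))))"

definition vgcd :: "int ^ 'd \<Rightarrow> nat" where
  "vgcd x = nat (Gcd (range (\<lambda>i. x $ i)))"

definition mu_gcd :: "(int ^ 'd) set \<Rightarrow> (int ^ 'd \<Rightarrow> nat) measure" where
  "mu_gcd F = distr (measure_pmf (pmf_of_set F)) borel (\<lambda>y x. vgcd (x + y))"

text \<open>
  Tightness and weak convergence in arbitrary topological spaces; the library has them
  for measures on the real line only.
\<close>

definition tight_family :: "('i \<Rightarrow> 'a::topological_space measure) \<Rightarrow> bool" where
  "tight_family M \<longleftrightarrow> (\<forall>\<epsilon>>0. \<exists>K. compact K \<and> (\<forall>i. measure (M i) K > 1 - \<epsilon>))"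

definition weakly_converges :: "(nat \<Rightarrow> 'a::topological_space measure) \<Rightarrow> 'a measure \<Rightarrow> bool" where
  "weakly_converges M N \<longleftrightarrow>
     (\<forall>n. prob_space (M n) \<and> sets (M n) = sets borel) \<and>
     prob_space N \<and> sets N = sets borel \<and>
     (\<forall>f :: 'a \<Rightarrow> real. continuous_on UNIV f \<longrightarrow> bounded (range f) \<longrightarrow>
        (\<lambda>n. \<integral>x. f x \<partial>M n) \<longlonglongrightarrow> (\<integral>x. f x \<partial>N))"

lemma tight_family_real_iff:
  fixes M :: "nat \<Rightarrow> real measure"
  assumes M: "\<And>n. real_distribution (M n)"
  shows "tight_family M \<longleftrightarrow> tight M"
proof
  assume L: "tight_family M"
  show "tight M" unfolding tight_def
  proof (intro conjI allI impI M)
    fix \<epsilon> :: real assume "\<epsilon> > 0"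
    then obtain K where K: "compact K" "\<And>n. measure (M n) K > 1 - \<epsilon>"
      using L unfolding tight_family_def by blast
    obtain c where c: "\<And>x. x \<in> K \<Longrightarrow> \<bar>x\<bar> \<le> c"
      using compact_imp_bounded[OF K(1)] unfolding bounded_iff by auto
    have sub: "K \<subseteq> {- \<bar>c\<bar> - 1 <.. \<bar>c\<bar>}" using c by fastforce
    have "measure (M n) {- \<bar>c\<bar> - 1 <.. \<bar>c\<bar>} > 1 - \<epsilon>" for n
    proof -
      interpret real_distribution "M n" by (rule M)
      have "measure (M n) K \<le> measure (M n) {- \<bar>c\<bar> - 1 <.. \<bar>c\<bar>}"
        by (rule finite_measure_mono[OF sub]) simp
      with K(2)[of n] show ?thesis by simp
    qed
    then show "\<exists>a b. a < b \<and> (\<forall>n. 1 - \<epsilon> < measure (M n) {a<..b})"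
      by (intro exI[of _ "- \<bar>c\<bar> - 1"] exI[of _ "\<bar>c\<bar>"]) auto
  qed
next
  assume R: "tight M"
  show "tight_family M" unfolding tight_family_def
  proof (intro allI impI)
    fix \<epsilon> :: real assume "\<epsilon> > 0"
    then obtain a b where ab: "\<And>n. measure (M n) {a<..b} > 1 - \<epsilon>"
      using R unfolding tight_def by blast
    have "measure (M n) {a..b} > 1 - \<epsilon>" for n
    proof -
      interpret real_distribution "M n" by (rule M)
      have "measure (M n) {a<..b} \<le> measure (M n) {a..b}"
        by (rule finite_measure_mono) auto
      with ab[of n] show ?thesis by simp
    qed
    then show "\<exists>K. compact K \<and> (\<forall>n. 1 - \<epsilon> < measure (M n) K)"
      by (intro exI[of _ "{a..b}"]) auto
  qed
qed

definition lattice_cosets :: "nat \<Rightarrow> (int ^ 'd) set set" where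
  "lattice_cosets m = range (\<lambda>a. (\<lambda>z. a + int m *s z) ` UNIV)"

definition coset_space :: "nat \<Rightarrow> nat \<Rightarrow> (int ^ 'd) set measure" where
  "coset_space p n = count_space (lattice_cosets (p ^ n))"

text \<open>
  The conditional law of \<open>W\<^sub>n\<close> given \<open>W\<^sub>0, \<dots>, W\<^bsub>n-1\<^esub>\<close>. For \<open>n = 0\<close> it is concentrated on
  the only coset of \<open>p\<^sup>0\<int>\<^sup>d\<close>, which is \<open>\<int>\<^sup>d\<close> itself.
\<close>

definition coset_kernel ::
    "nat \<Rightarrow> nat \<Rightarrow> (nat \<Rightarrow> (int ^ 'd) set) \<Rightarrow> (int ^ 'd) set measure" where
  "coset_kernel p n W =
     uniform_measure (coset_space p n) {C \<in> lattice_cosets (p ^ n). n = 0 \<or> C \<subseteq> W (n - 1)}"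

text \<open>
  The law of the sequence \<open>(W\<^sub>n)\<close>, from the Ionescu-Tulcea theorem; its hypotheses are
  checked in \<open>Ionescu_Tulcea_coset\<close> below.
\<close>

definition coset_chain :: "nat \<Rightarrow> (nat \<Rightarrow> (int ^ 'd) set) measure" where
  "coset_chain p =
     projective_family.lim UNIV (Ionescu_Tulcea.CI (coset_kernel p) (coset_space p)) (coset_space p)"

definition coset_chains :: "(nat \<Rightarrow> nat \<Rightarrow> (int ^ 'd) set) measure" where
  "coset_chains = PiM {p. prime p} coset_chain"

definition chain_val :: "(nat \<Rightarrow> (int ^ 'd) set) \<Rightarrow> int ^ 'd \<Rightarrow> enat" where
  "chain_val W x = Sup {enat n | n. x \<in> W n}"

definition enat_power :: "nat \<Rightarrow> enat \<Rightarrow> enat" where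
  "enat_power p v = (case v of enat n \<Rightarrow> enat (p ^ n) | \<infinity> \<Rightarrow> \<infinity>)"

text \<open>
  All factors are at least \<open>1\<close>, so the infinite product is the supremum of the (increasing)
  partial products, with the convention that it is \<open>0\<close> when all the exponents are infinite.
\<close>

definition prime_power_prod :: "(nat \<Rightarrow> enat) \<Rightarrow> enat" where
  "prime_power_prod v =
     (if \<forall>p. prime p \<longrightarrow> v p = \<infinity> then 0
      else (SUP n. \<Prod>p | prime p \<and> p \<le> n. enat_power p (v p)))"

definition mu_inf_gcd_ext :: "(int ^ 'd \<Rightarrow> enat) measure" where
  "mu_inf_gcd_ext =
     distr coset_chains (PiM UNIV (\<lambda>_. count_space UNIV))
       (\<lambda>W x. prime_power_prod (\<lambda>p. chain_val (W p) x))"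

text \<open>
  For \<open>d \<ge> 2\<close> all values are almost surely finite, and \<open>the_enat\<close> only identifies
  \<open>enat k\<close> with \<open>k\<close>. For \<open>d = 1\<close> the measure below carries no meaning.
\<close>

definition mu_inf_gcd :: "(int ^ 'd \<Rightarrow> nat) measure" where
  "mu_inf_gcd = distr mu_inf_gcd_ext borel (\<lambda>f x. the_enat (f x))"

lemma lattice_cosets_finite:
  assumes "m > 0" shows "finite (lattice_cosets m :: (int ^ 'd) set set)"
proof -
  let ?c = "\<lambda>a. (\<lambda>z. a + int m *s z) ` UNIV :: (int ^ 'd) set"
  let ?R = "{a :: int ^ 'd. \<forall>i. a $ i \<in> {0..<int m}}"
  have "?R = (\<lambda>f. \<chi> i. f i) ` (PiE UNIV (\<lambda>_. {0..<int m}))"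
  proof (intro set_eqI iffI)
    fix a :: "int ^ 'd" assume "a \<in> ?R"
    then show "a \<in> (\<lambda>f. \<chi> i. f i) ` (PiE UNIV (\<lambda>_. {0..<int m}))"
      by (intro image_eqI[of _ _ "vec_nth a"]) auto
  qed auto
  then have fin: "finite ?R" by (simp add: finite_PiE)
  have "?c a \<in> ?c ` ?R" for a :: "int ^ 'd"
  proof -
    define r :: "int ^ 'd" where "r = (\<chi> i. a $ i mod int m)"
    define q :: "int ^ 'd" where "q = (\<chi> i. a $ i div int m)"
    have a: "a = r + int m *s q" by (simp add: r_def q_def vec_eq_iff)
    have "?c a = ?c r"
    proof (intro set_eqI iffI; elim imageE)
      fix x z assume "x = a + int m *s z"
      then have "x = r + int m *s (q + z)" by (simp add: a vec_eq_iff algebra_simps)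
      then show "x \<in> ?c r" by blast
    next
      fix x z assume "x = r + int m *s z"
      then have "x = a + int m *s (z - q)" by (simp add: a vec_eq_iff algebra_simps)
      then show "x \<in> ?c a" by blast
    qed
    moreover have "r \<in> ?R" using assms by (simp add: r_def)
    ultimately show ?thesis by blast
  qed
  then have "lattice_cosets m \<subseteq> ?c ` ?R" unfolding lattice_cosets_def by blast
  with fin show ?thesis by (meson finite_imageI finite_subset)
qed

lemma lattice_cosets_Suc_ex:
  fixes D :: "(int ^ 'd) set"
  assumes "D \<in> lattice_cosets (p ^ n)"
  shows "\<exists>C \<in> lattice_cosets (p ^ Suc n). C \<subseteq> D"
proof -
  obtain a where D: "D = (\<lambda>z. a + int (p ^ n) *s z) ` UNIV"
    using assms unfolding lattice_cosets_def by blast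
  have "a + int (p ^ Suc n) *s z = a + int (p ^ n) *s (int p *s z)" for z
    by (simp add: vec_eq_iff algebra_simps)
  then have "(\<lambda>z. a + int (p ^ Suc n) *s z) ` UNIV \<subseteq> D" unfolding D by blast
  then show ?thesis unfolding lattice_cosets_def by blast
qed

lemma prob_space_coset_kernel:
  fixes W :: "nat \<Rightarrow> (int ^ 'd) set"
  assumes p: "p > 0" and W: "n = 0 \<or> W (n - 1) \<in> lattice_cosets (p ^ (n - 1))"
  shows "prob_space (coset_kernel p n W)"
proof -
  let ?A = "{C \<in> lattice_cosets (p ^ n). n = 0 \<or> C \<subseteq> W (n - 1)}"
  have fin: "finite ?A"
    by (rule finite_subset[OF _ lattice_cosets_finite[of "p ^ n"]]) (use p in auto)
  have "?A \<noteq> {}"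
  proof (cases n)
    case 0
    then show ?thesis by (auto simp: lattice_cosets_def)
  next
    case (Suc k)
    then show ?thesis using lattice_cosets_Suc_ex[of "W k" p k] W by auto
  qed
  then have "emeasure (coset_space p n) ?A \<noteq> 0" "emeasure (coset_space p n) ?A \<noteq> \<infinity>"
    using fin unfolding coset_space_def by (auto simp: emeasure_count_space)
  then show ?thesis unfolding coset_kernel_def by (rule prob_space_uniform_measure)
qed

lemma sets_coset_kernel: "sets (coset_kernel p n W) = sets (coset_space p n)"
  by (simp add: coset_kernel_def)

lemma Ionescu_Tulcea_coset:
  assumes p: "p > 0"
  shows "Ionescu_Tulcea
    (coset_kernel p :: nat \<Rightarrow> (nat \<Rightarrow> (int ^ 'd) set) \<Rightarrow> _) (coset_space p)"
proof (rule Ionescu_Tulcea.intro)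
  fix n and W :: "nat \<Rightarrow> (int ^ 'd) set"
  assume "W \<in> space (PiM {0..<n} (coset_space p))"
  then have "n = 0 \<or> W (n - 1) \<in> lattice_cosets (p ^ (n - 1))"
    by (auto simp: space_PiM PiE_iff coset_space_def)
  then show "prob_space (coset_kernel p n W)" by (rule prob_space_coset_kernel[OF p])
next
  fix n
  show "(coset_kernel p n :: (nat \<Rightarrow> (int ^ 'd) set) \<Rightarrow> _)
      \<in> measurable (PiM {0..<n} (coset_space p)) (subprob_algebra (coset_space p n))"
  proof (cases n)
    case 0
    have "coset_kernel p n = (\<lambda>_ :: nat \<Rightarrow> (int ^ 'd) set. coset_kernel p n (\<lambda>_. UNIV))"
      by (simp add: coset_kernel_def fun_eq_iff 0)
    moreover have "coset_kernel p n (\<lambda>_. UNIV :: (int ^ 'd) set)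
        \<in> space (subprob_algebra (coset_space p n))"
      using prob_space_coset_kernel[OF p, of n "\<lambda>_. UNIV :: (int ^ 'd) set"] 0
      by (auto simp: space_subprob_algebra sets_coset_kernel prob_space_imp_subprob_space)
    ultimately show ?thesis by (metis measurable_const)
  next
    case (Suc k)
    let ?g = "\<lambda>D :: (int ^ 'd) set. coset_kernel p n (\<lambda>_. D)"
    have eq: "coset_kernel p n = (\<lambda>W :: nat \<Rightarrow> (int ^ 'd) set. ?g (W k))"
      by (simp add: coset_kernel_def fun_eq_iff Suc)
    have "?g D \<in> space (subprob_algebra (coset_space p n))" if "D \<in> lattice_cosets (p ^ k)" for D
    proof -
      have "prob_space (?g D)"
        by (rule prob_space_coset_kernel[OF p]) (use that Suc in simp)
      then show ?thesis
        by (simp add: space_subprob_algebra sets_coset_kernel prob_space_imp_subprob_space)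
    qed
    then have "?g \<in> measurable (coset_space p k) (subprob_algebra (coset_space p n))"
      unfolding coset_space_def[of p k] measurable_count_space_eq1 by blast
    moreover have "(\<lambda>W. W k) \<in> measurable (PiM {0..<n} (coset_space p)) (coset_space p k)"
      using Suc by (intro measurable_component_singleton) auto
    ultimately show ?thesis by (subst eq) (rule measurable_compose[rotated])
  qed
qed

lemma
  assumes "p > 0"
  shows prob_space_coset_chain: "prob_space (coset_chain p :: (nat \<Rightarrow> (int ^ 'd) set) measure)"
    and sets_coset_chain:
      "sets (coset_chain p :: (nat \<Rightarrow> (int ^ 'd) set) measure) = sets (PiM UNIV (coset_space p))"
proof -
  interpret Ionescu_Tulcea "coset_kernel p :: nat \<Rightarrow> (nat \<Rightarrow> (int ^ 'd) set) \<Rightarrow> _" "coset_space p"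
    by (rule Ionescu_Tulcea_coset[OF assms])
  show "sets (coset_chain p :: (nat \<Rightarrow> (int ^ 'd) set) measure) = sets (PiM UNIV (coset_space p))"
    unfolding coset_chain_def by simp
  show "prob_space (coset_chain p :: (nat \<Rightarrow> (int ^ 'd) set) measure)"
    unfolding coset_chain_def
  proof (rule prob_space_distrD)
    show "(\<lambda>x. restrict x {}) \<in> measurable PF.lim (PiM {} (coset_space p))"
      unfolding measurable_cong_sets[OF PF.sets_lim refl] by (rule measurable_restrict_subset) simp
    show "prob_space (distr PF.lim (PiM {} (coset_space p)) (\<lambda>x. restrict x {}))"
      unfolding distr_lim[OF finite.emptyI] by (rule PF.prob_space_P) simp_all
  qed
qed

lemma prob_space_coset_chains: "prob_space (coset_chains :: (nat \<Rightarrow> nat \<Rightarrow> (int ^ 'd) set) measure)"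
  unfolding coset_chains_def
  by (intro prob_space_PiM prob_space_coset_chain) (auto intro: prime_gt_0_nat)

lemma measurable_chain_val:
  assumes p: "prime p"
  shows "(\<lambda>W. chain_val (W p) (x :: int ^ 'd)) \<in> measurable coset_chains (count_space UNIV)"
proof -
  have eq: "chain_val V x = (SUP n. if x \<in> V n then enat n else 0)" for V
  proof (rule antisym)
    show "chain_val V x \<le> (SUP n. if x \<in> V n then enat n else 0)"
      unfolding chain_val_def
    proof (rule Sup_least)
      fix y assume "y \<in> {enat n | n. x \<in> V n}"
      then obtain n where "y = enat n" "x \<in> V n" by blast
      then show "y \<le> (SUP n. if x \<in> V n then enat n else 0)"
        by (intro SUP_upper2[of n]) auto
    qed
    show "(SUP n. if x \<in> V n then enat n else 0) \<le> chain_val V x"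
      unfolding chain_val_def by (rule SUP_least) (auto intro!: Sup_upper)
  qed
  have 1: "(\<lambda>W. W p) \<in> measurable coset_chains (coset_chain p :: (nat \<Rightarrow> (int ^ 'd) set) measure)"
    unfolding coset_chains_def using p by (intro measurable_component_singleton) simp
  have 2: "(\<lambda>V. V n) \<in> measurable (coset_chain p :: (nat \<Rightarrow> (int ^ 'd) set) measure) (coset_space p n)" for n
    using measurable_component_singleton[of n UNIV "coset_space p"]
    by (simp add: measurable_cong_sets[OF sets_coset_chain[OF prime_gt_0_nat[OF p]] refl])
  have 3: "(\<lambda>W. if x \<in> W p n then enat n else 0) \<in> measurable coset_chains (count_space UNIV)" for n
  proof -
    have "(\<lambda>C :: (int ^ 'd) set. if x \<in> C then enat n else 0)
        \<in> measurable (coset_space p n) (count_space UNIV)"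
      by (simp add: coset_space_def)
    from measurable_compose[OF measurable_compose[OF 1 2[of n]] this] show ?thesis .
  qed
  show ?thesis unfolding eq by (rule measurable_SUP) (auto intro: 3)
qed

lemma measurable_prime_power_prod:
  "(\<lambda>W. prime_power_prod (\<lambda>p. chain_val (W p) (x :: int ^ 'd)))
     \<in> measurable coset_chains (count_space UNIV)"
proof -
  have pow: "(\<lambda>W. enat_power p (chain_val (W p) x)) \<in> measurable coset_chains (count_space UNIV)"
    if "prime p" for p
    by (rule measurable_compose[OF measurable_chain_val[OF that]]) simp
  have prod: "(\<lambda>W. \<Prod>p\<in>A. enat_power p (chain_val (W p) x)) \<in> measurable coset_chains (count_space UNIV)"
    if "finite A" "\<forall>p\<in>A. prime p" for A
    using that
  proof (induction A rule: finite_induct)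
    case (insert p A)
    let ?Q = "\<lambda>W. \<Prod>p\<in>A. enat_power p (chain_val (W p) x)"
    have Q: "?Q \<in> measurable coset_chains (count_space UNIV)"
      using insert by simp
    have "(\<lambda>W. c * ?Q W) \<in> measurable coset_chains (count_space UNIV)" for c
      by (rule measurable_compose[OF Q]) simp
    then have "(\<lambda>W. enat_power p (chain_val (W p) x) * ?Q W)
        \<in> measurable coset_chains (count_space UNIV)"
      by (rule measurable_compose_countable) (use insert in \<open>auto intro: pow\<close>)
    then show ?case using insert by simp
  qed simp
  have sup: "(\<lambda>W. SUP n. \<Prod>p | prime p \<and> p \<le> n. enat_power p (chain_val (W p) x))
      \<in> measurable coset_chains (count_space UNIV)"
    by (rule measurable_SUP) (auto intro!: prod)
  have "Measurable.pred coset_chains (\<lambda>W. chain_val (W p) x = \<infinity>)" if "prime p" for p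
    by (rule measurable_compose[OF measurable_chain_val[OF that]]) simp
  then have "Measurable.pred coset_chains (\<lambda>W. prime p \<longrightarrow> chain_val (W p) x = \<infinity>)" for p
    by (cases "prime p") simp_all
  then have "Measurable.pred coset_chains (\<lambda>W. \<forall>p. prime p \<longrightarrow> chain_val (W p) x = \<infinity>)"
    by (rule pred_intros_countable(1))
  then show ?thesis unfolding prime_power_prod_def
    by (intro measurable_If sup measurable_const) (simp_all add: pred_def)
qed

lemma prob_space_mu_inf_gcd_ext: "prob_space (mu_inf_gcd_ext :: (int ^ 'd \<Rightarrow> enat) measure)"
  unfolding mu_inf_gcd_ext_def
  by (intro prob_space.prob_space_distr prob_space_coset_chains measurable_PiM_single')
     (auto intro: measurable_prime_power_prod)

lemma prob_space_mu_inf_gcd: "prob_space (mu_inf_gcd :: (int ^ 'd \<Rightarrow> nat) measure)"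
  unfolding mu_inf_gcd_def
proof (intro prob_space.prob_space_distr prob_space_mu_inf_gcd_ext measurable_coordinatewise_then_product)
  fix x :: "int ^ 'd"
  have "(\<lambda>f. f x) \<in> measurable mu_inf_gcd_ext (count_space UNIV)"
    unfolding mu_inf_gcd_ext_def by simp
  from measurable_compose[OF this, of the_enat borel]
  show "(\<lambda>f. the_enat (f x)) \<in> borel_measurable mu_inf_gcd_ext" by simp
qed

end

theory Submission
  imports Defs
begin

text \<open>
  A Folner sequence is asymptotically invariant under translations, hence equidistributed
  modulo every \<open>m\<close>: for a function \<open>h\<close> on the lattice that depends only on residues modulo
  \<open>m\<close>, the averages of \<open>h\<close> over \<open>F n\<close> tend to its average over one period box
  (\<open>average_periodic\<close>). For fixed \<open>m\<close> the configuration
  \<open>x \<mapsto> gcd m (vgcd (x + y))\<close> is such a function of \<open>y\<close>. The proof is therefore a comparison of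
  the gcds with their truncations, along the moduli
  \<open>m\<^sub>T = \<Prod>\<^bsub>p \<le> T\<^esub> p\<^sup>T\<close>, which become divisible by every positive integer.

  On the side of the limit, the chains \<open>W p 0 \<supseteq> W p 1 \<supseteq> \<dots>\<close> amount to a uniformly distributed
  profinite vector: almost surely the cosets of level at most \<open>T\<close> of the primes at most \<open>T\<close> are
  the classes of \<open>- r\<^sub>T\<close> for one vector \<open>r\<^sub>T\<close> modulo \<open>m\<^sub>T\<close>, the vectors \<open>r\<^sub>T\<close> are compatible, and
  each \<open>r\<^sub>T\<close> is uniform (\<open>level_event_law\<close>, \<open>AE_profinite\<close>). So the truncated gcds
  \<open>gcd m\<^sub>T (vgcd (x + r\<^sub>T))\<close> of the limit object have exactly the law to which the truncated gcds
  along \<open>F n\<close> converge.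

  It remains to remove the truncation, and tightness does this on both sides. Along \<open>F n\<close>,
  with probability close to \<open>1\<close> the value \<open>vgcd (x + y)\<close> lies in \<open>{1..L}\<close>; the value \<open>0\<close> has vanishing
  probability because finite sets do (\<open>average_finite_set\<close>). As soon as \<open>T \<ge> L\<close>, a value in
  \<open>{1..L}\<close> divides \<open>m\<^sub>T\<close> and truncation does not change it. For the limit object, the
  probability that \<open>gcd m\<^sub>T (vgcd (x + r\<^sub>T))\<close> exceeds \<open>L\<close> is a limit of the corresponding
  frequencies along \<open>F n\<close>, hence small uniformly in \<open>T\<close>. Since these gcds form a divisibility
  chain in \<open>T\<close>, they are almost surely bounded and so eventually constant, and their final
  value is the product of the primes \<open>p\<close> to the powers \<open>V\<^sub>p(x)\<close>
  (\<open>AE_level_gcd_bounded\<close>, \<open>level_gcd_eventually_limit\<close>). Finiteness of the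
  limit is thus inherited from tightness.

  These arguments give convergence for bounded functions of finitely many sites. A bounded
  continuous function on the product space is a pointwise increasing limit of such functions, so
  a one-sided estimate applied to \<open>f\<close> and \<open>- f\<close> gives weak convergence
  (\<open>weakly_convergesI_finite_sites\<close>).
\<close>


section \<open>Divisibility and residues in the lattice\<close>

lemma dvd_vgcd_iff: "n dvd vgcd y \<longleftrightarrow> (\<forall>i. int n dvd y $ i)"
proof -
  have "int (vgcd y) = Gcd (range (\<lambda>i. y $ i))"
    by (simp add: vgcd_def)
  then have "n dvd vgcd y \<longleftrightarrow> int n dvd Gcd (range (\<lambda>i. y $ i))"
    by (metis int_dvd_int_iff)
  then show ?thesis by (auto simp: dvd_Gcd_iff)
qed

lemma vgcd_eq_0_iff: "vgcd y = 0 \<longleftrightarrow> y = 0"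
  using dvd_vgcd_iff[of 0 y] by (simp add: vec_eq_iff)

definition residue_box :: "nat \<Rightarrow> (int ^ 'd) set" where
  "residue_box m = {r. \<forall>i. r $ i \<in> {0..<int m}}"

definition vmod :: "int ^ 'd \<Rightarrow> nat \<Rightarrow> int ^ 'd" where
  "vmod y m = (\<chi> i. y $ i mod int m)"

lemma vmod_in_residue_box: "m > 0 \<Longrightarrow> vmod y m \<in> residue_box m"
  by (simp add: vmod_def residue_box_def)

lemma residue_box_eq_image: "residue_box m = (\<lambda>f. \<chi> i. f i) ` PiE UNIV (\<lambda>_. {0..<int m})"
proof (intro set_eqI iffI)
  fix a :: "int ^ 'd" assume "a \<in> residue_box m"
  then show "a \<in> (\<lambda>f. \<chi> i. f i) ` PiE UNIV (\<lambda>_. {0..<int m})"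
    by (intro image_eqI[of _ _ "vec_nth a"]) (auto simp: residue_box_def)
qed (auto simp: residue_box_def)

lemma finite_residue_box: "finite (residue_box m)"
  by (simp add: residue_box_eq_image finite_PiE)

lemma card_residue_box: "card (residue_box m :: (int ^ 'd) set) = m ^ CARD('d)"
proof -
  have "inj_on (\<lambda>f. (\<chi> i. f i) :: int ^ 'd) (PiE UNIV (\<lambda>_. {0..<int m}))"
    by (auto simp: inj_on_def vec_eq_iff)
  then show ?thesis
    by (simp add: residue_box_eq_image card_image card_PiE)
qed

lemma residue_box_eqI:
  assumes r: "r \<in> residue_box m" "s \<in> residue_box m" and dvd: "\<And>i. int m dvd r $ i - s $ i"
  shows "r = s"
proof -
  have "r $ i = s $ i" for i
  proof -
    have "r $ i mod int m = s $ i mod int m"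
      using dvd[of i] by (simp add: mod_eq_dvd_iff)
    moreover have "r $ i mod int m = r $ i" "s $ i mod int m = s $ i"
      using r by (auto simp: residue_box_def)
    ultimately show ?thesis by simp
  qed
  then show ?thesis by (simp add: vec_eq_iff)
qed

text \<open>
  Invariance under the lattice \<open>m\<int>\<^sup>d\<close>, phrased through divisibility of the coordinates because
  the arguments below produce it in this form.
\<close>

definition lattice_periodic :: "nat \<Rightarrow> (int ^ 'd \<Rightarrow> 'a) \<Rightarrow> bool" where
  "lattice_periodic m h \<longleftrightarrow> (\<forall>y z. (\<forall>i. int m dvd y $ i - z $ i) \<longrightarrow> h y = h z)"

lemma lattice_periodicD: "lattice_periodic m h \<Longrightarrow> (\<And>i. int m dvd y $ i - z $ i) \<Longrightarrow> h y = h z"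
  unfolding lattice_periodic_def by blast

lemma lattice_periodic_vmod: "lattice_periodic m h \<Longrightarrow> h (vmod y m) = h y"
  by (rule lattice_periodicD) (auto simp: vmod_def mod_eq_dvd_iff[symmetric])

text \<open>
  A translate of a period box is again a system of representatives of the residues modulo \<open>m\<close>.
\<close>

lemma sum_residue_box_shift:
  fixes h :: "int ^ 'd \<Rightarrow> 'a::comm_monoid_add"
  assumes m: "m > 0" and h: "lattice_periodic m h"
  shows "(\<Sum>r\<in>residue_box m. h (y + r)) = (\<Sum>r\<in>residue_box m. h r)"
proof -
  let ?g = "\<lambda>r. vmod (y + r) m"
  have "inj_on ?g (residue_box m)"
  proof (rule inj_onI)
    fix r s assume rs: "r \<in> residue_box m" "s \<in> residue_box m" and eq: "?g r = ?g s"
    show "r = s"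
    proof (rule residue_box_eqI[OF rs])
      fix i
      have "(y $ i + r $ i) mod int m = (y $ i + s $ i) mod int m"
        using eq by (simp add: vmod_def vec_eq_iff)
      then show "int m dvd r $ i - s $ i" by (simp add: mod_eq_dvd_iff)
    qed
  qed
  moreover have "?g ` residue_box m \<subseteq> residue_box m"
    using vmod_in_residue_box[OF m] by blast
  ultimately have "bij_betw ?g (residue_box m) (residue_box m)"
    by (simp add: bij_betw_def endo_inj_surj finite_residue_box)
  from sum.reindex_bij_betw[OF this, of h]
  show ?thesis by (simp add: lattice_periodic_vmod[OF h])
qed

text \<open>
  The divisors of \<open>gcd m (vgcd (x + y))\<close> are the divisors \<open>k\<close> of \<open>m\<close> with \<open>k\<close> dividing all
  coordinates of \<open>x + y\<close>, and such a \<open>k\<close> sees \<open>y\<close> only modulo \<open>m\<close>.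
\<close>

lemma lattice_periodic_gcd:
  fixes x :: "int ^ 'd"
  shows "lattice_periodic m (\<lambda>y. gcd m (vgcd (x + y)))"
  unfolding lattice_periodic_def
proof (intro allI impI)
  fix y z :: "int ^ 'd" assume yz: "\<forall>i. int m dvd y $ i - z $ i"
  have "k dvd m \<Longrightarrow> k dvd vgcd (x + y) \<longleftrightarrow> k dvd vgcd (x + z)" for k
  proof -
    assume k: "k dvd m"
    have "int k dvd (x + y) $ i \<longleftrightarrow> int k dvd (x + z) $ i" for i
    proof -
      have "int k dvd y $ i - z $ i" using yz k by (meson dvd_trans int_dvd_int_iff)
      from dvd_add_right_iff[OF this, of "x $ i + z $ i"] show ?thesis by (simp add: algebra_simps)
    qed
    then show ?thesis by (simp add: dvd_vgcd_iff)
  qed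
  then show "gcd m (vgcd (x + y)) = gcd m (vgcd (x + z))"
    by (intro dvd_antisym) (auto intro: gcd_greatest)
qed

lemma lattice_periodic_gcd_configuration:
  fixes f :: "(int ^ 'd \<Rightarrow> nat) \<Rightarrow> 'a"
  shows "lattice_periodic m (\<lambda>r. f (\<lambda>x. gcd m (vgcd (x + r))))"
  unfolding lattice_periodic_def
proof (intro allI impI)
  fix y z :: "int ^ 'd" assume yz: "\<forall>i. int m dvd y $ i - z $ i"
  have "gcd m (vgcd (x + y)) = gcd m (vgcd (x + z))" for x
    by (rule lattice_periodicD[OF lattice_periodic_gcd]) (use yz in blast)
  then show "f (\<lambda>x. gcd m (vgcd (x + y))) = f (\<lambda>x. gcd m (vgcd (x + z)))" by simp
qed

section \<open>Equidistribution along Folner sequences\<close>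

definition average :: "'a set \<Rightarrow> ('a \<Rightarrow> real) \<Rightarrow> real" where
  "average F h = (\<Sum>y\<in>F. h y) / real (card F)"

lemma folner_finite: "folner F \<Longrightarrow> finite (F n)"
  and folner_nonempty: "folner F \<Longrightarrow> F n \<noteq> {}"
  unfolding folner_def by auto

lemma folner_card_pos: "folner F \<Longrightarrow> card (F n) > 0"
  by (simp add: folner_finite folner_nonempty card_gt_0_iff)

lemma average_mono: "(\<And>y. y \<in> F \<Longrightarrow> h y \<le> g y) \<Longrightarrow> average F h \<le> average F g"
  unfolding average_def by (intro divide_right_mono sum_mono) auto

lemma average_diff: "average F (\<lambda>y. h y - g y) = average F h - average F g"
  by (simp add: average_def sum_subtractf diff_divide_distrib)

lemma average_add: "average F (\<lambda>y. h y + g y) = average F h + average F g"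
  by (simp add: average_def sum.distrib add_divide_distrib)

lemma average_cmult: "average F (\<lambda>y. c * h y) = c * average F h"
  by (simp add: average_def sum_distrib_left)

lemma average_sum: "average F (\<lambda>y. \<Sum>i\<in>A. h i y) = (\<Sum>i\<in>A. average F (h i))"
  unfolding average_def by (subst sum.swap) (simp add: sum_divide_distrib)

lemma average_const: "finite F \<Longrightarrow> F \<noteq> {} \<Longrightarrow> average F (\<lambda>_. c) = c"
  by (simp add: average_def)

lemma average_nonneg: "(\<And>y. y \<in> F \<Longrightarrow> 0 \<le> h y) \<Longrightarrow> 0 \<le> average F h"
  unfolding average_def by (intro divide_nonneg_nonneg sum_nonneg) auto

lemma abs_average_le: "\<bar>average F h\<bar> \<le> average F (\<lambda>y. \<bar>h y\<bar>)"
  unfolding average_def by (simp add: divide_right_mono)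

text \<open>
  The two sums differ only over the symmetric difference of \<open>F n\<close> and its translate by \<open>x\<close>, and
  this set is negligible by the Folner property.
\<close>

lemma average_shift:
  fixes h :: "int ^ 'd \<Rightarrow> real"
  assumes F: "folner F" and B: "\<And>y. \<bar>h y\<bar> \<le> B"
  shows "(\<lambda>n. average (F n) (\<lambda>y. h (x + y)) - average (F n) h) \<longlonglongrightarrow> 0"
proof -
  let ?D = "\<lambda>n. sym_diff (F n) ((\<lambda>y. y + x) ` F n)"
  have B0: "B \<ge> 0" using B[of 0] by linarith
  have "(\<lambda>n. real (card (?D n))) \<in> o(\<lambda>n. real (card (F n)))"
    using F by (simp add: folner_def)
  then have "(\<lambda>n. real (card (?D n)) / real (card (F n))) \<longlonglongrightarrow> 0"
    by (rule smalloD_tendsto)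
  then have lim: "(\<lambda>n. B * (real (card (?D n)) / real (card (F n)))) \<longlonglongrightarrow> 0"
    by (rule tendsto_mult_right_zero)
  have bound: "norm (average (F n) (\<lambda>y. h (x + y)) - average (F n) h)
      \<le> B * (real (card (?D n)) / real (card (F n)))" for n
  proof -
    let ?G = "(\<lambda>y. y + x) ` F n"
    note fin = folner_finite[OF F, of n]
    have "(\<Sum>y\<in>F n. h (x + y)) = sum h ?G"
      by (subst sum.reindex) (auto simp: add.commute)
    moreover have "sum h ?G - sum h (F n) = sum h (?G - F n) - sum h (F n - ?G)"
    proof -
      have "sum h ?G = sum h (?G - F n) + sum h (?G \<inter> F n)"
        using fin by (metis finite_imageI sum.Int_Diff add.commute)
      moreover have "sum h (F n) = sum h (F n - ?G) + sum h (?G \<inter> F n)"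
        using fin by (metis sum.Int_Diff add.commute Int_commute)
      ultimately show ?thesis by simp
    qed
    moreover have "\<bar>sum h (?G - F n)\<bar> \<le> B * card (?G - F n)" "\<bar>sum h (F n - ?G)\<bar> \<le> B * card (F n - ?G)"
      using sum_norm_bound[of _ h B] B by (simp_all add: mult.commute)
    moreover have "real (card (?D n)) = card (F n - ?G) + card (?G - F n)"
      using fin by (subst card_Un_disjoint) auto
    ultimately have "\<bar>(\<Sum>y\<in>F n. h (x + y)) - sum h (F n)\<bar> \<le> B * card (?D n)"
      by (simp add: distrib_left)
    then show ?thesis
      using folner_card_pos[OF F, of n]
      by (simp add: average_def diff_divide_distrib[symmetric] divide_right_mono abs_divide)
  qed
  show ?thesis by (rule Lim_null_comparison[OF _ lim]) (rule always_eventually, rule allI, rule bound)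
qed

lemma lattice_periodic_bounded:
  fixes h :: "int ^ 'd \<Rightarrow> real"
  assumes m: "m > 0" and h: "lattice_periodic m h"
  obtains B where "\<And>y. \<bar>h y\<bar> \<le> B"
proof
  fix y
  have "h (vmod y m) \<in> h ` residue_box m" using vmod_in_residue_box[OF m] by blast
  then show "\<bar>h y\<bar> \<le> Max (abs ` h ` residue_box m)"
    by (intro Max_ge) (auto simp: finite_residue_box lattice_periodic_vmod[OF h])
qed

text \<open>
  Averaging over all translates by \<open>r\<close> in a period box changes the averages along \<open>F n\<close> by
  \<open>o(1)\<close>, and turns \<open>h\<close> into a constant, its average over the box.
\<close>

lemma average_periodic:
  fixes h :: "int ^ 'd \<Rightarrow> real"
  assumes F: "folner F" and m: "m > 0" and h: "lattice_periodic m h"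
  shows "(\<lambda>n. average (F n) h) \<longlonglongrightarrow> average (residue_box m) h"
proof -
  let ?R = "residue_box m :: (int ^ 'd) set"
  have cR: "real (card ?R) > 0" using m by (simp add: card_residue_box)
  obtain B where B: "\<And>y. \<bar>h y\<bar> \<le> B" using lattice_periodic_bounded[OF m h] by blast
  have "(\<lambda>n. \<Sum>r\<in>?R. average (F n) (\<lambda>y. h (r + y)) - average (F n) h) \<longlonglongrightarrow> (\<Sum>r\<in>?R. 0)"
    by (intro tendsto_sum average_shift[OF F, of h B] B)
  moreover have "(\<Sum>r\<in>?R. average (F n) (\<lambda>y. h (r + y)) - average (F n) h)
      = sum h ?R - card ?R * average (F n) h" for n
  proof -
    have "(\<Sum>r\<in>?R. average (F n) (\<lambda>y. h (r + y))) = average (F n) (\<lambda>y. \<Sum>r\<in>?R. h (y + r))"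
      by (simp add: average_sum add.commute)
    also have "\<dots> = sum h ?R"
      by (simp add: sum_residue_box_shift[OF m h] average_const folner_finite[OF F] folner_nonempty[OF F])
    finally show ?thesis by (simp add: sum_subtractf)
  qed
  ultimately have "(\<lambda>n. sum h ?R - card ?R * average (F n) h) \<longlonglongrightarrow> 0" by simp
  then have "(\<lambda>n. (sum h ?R - (sum h ?R - card ?R * average (F n) h)) / card ?R)
      \<longlonglongrightarrow> (sum h ?R - 0) / card ?R"
    by (intro tendsto_intros) (use cR in auto)
  then show ?thesis using cR by (simp add: average_def)
qed

text \<open>
  A point \<open>s\<close> has at most the frequency of its residue class modulo \<open>m\<close>, which tends to
  \<open>m\<^sup>-\<^sup>d \<le> 1 / m\<close>; here \<open>m\<close> is arbitrary.
\<close>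

lemma average_finite_set:
  fixes S :: "(int ^ 'd) set"
  assumes F: "folner F" and S: "finite S"
  shows "(\<lambda>n. average (F n) (indicator S)) \<longlonglongrightarrow> 0"
proof -
  have single: "(\<lambda>n. average (F n) (indicator {s})) \<longlonglongrightarrow> 0" for s :: "int ^ 'd"
  proof (rule LIMSEQ_I)
    fix e :: real assume e: "e > 0"
    obtain m :: nat where m: "m > 0" "1 / real m < e"
      using e by (metis nat_approx_posE inverse_eq_divide zero_less_Suc)
    define h :: "int ^ 'd \<Rightarrow> real" where "h y = (if \<forall>i. int m dvd y $ i - s $ i then 1 else 0)" for y
    have h: "lattice_periodic m h"
      unfolding lattice_periodic_def
    proof (intro allI impI)
      fix y z :: "int ^ 'd" assume yz: "\<forall>i. int m dvd y $ i - z $ i"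
      have "int m dvd y $ i - s $ i \<longleftrightarrow> int m dvd z $ i - s $ i" for i
        using dvd_add_right_iff[of "int m" "y $ i - z $ i" "z $ i - s $ i"] yz by simp
      then show "h y = h z" by (simp add: h_def)
    qed
    have "sum h (residue_box m) \<le> (\<Sum>r\<in>{vmod s m}. 1)"
    proof -
      have "r = vmod s m" if "r \<in> residue_box m" "h r \<noteq> 0" for r
      proof (rule residue_box_eqI[OF that(1) vmod_in_residue_box[OF m(1)]])
        fix i
        have "int m dvd r $ i - s $ i" using that(2) by (simp add: h_def split: if_splits)
        then show "int m dvd r $ i - vmod s m $ i"
          by (simp add: vmod_def mod_eq_dvd_iff[symmetric])
      qed
      then have "sum h (residue_box m) = sum h (residue_box m \<inter> {vmod s m})"
        by (intro sum.mono_neutral_right) (auto simp: finite_residue_box)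
      also have "\<dots> \<le> (\<Sum>r\<in>{vmod s m}. 1)"
        by (auto simp: h_def Int_insert_right)
      finally show ?thesis .
    qed
    then have "average (residue_box m) h \<le> 1 / real (m ^ CARD('d))"
      by (simp add: average_def card_residue_box divide_right_mono)
    also have "\<dots> \<le> 1 / real m"
    proof -
      have "m ^ 1 \<le> m ^ CARD('d)" using m(1) by (intro power_increasing) (auto simp: Suc_le_eq)
      then show ?thesis using m(1) by (intro divide_left_mono) (auto simp flip: of_nat_power)
    qed
    finally have "average (residue_box m) h < e" using m(2) by simp
    then have "eventually (\<lambda>n. average (F n) h < e) sequentially"
      using average_periodic[OF F m(1) h] by (simp add: order_tendsto_iff)
    then obtain N where N: "\<And>n. n \<ge> N \<Longrightarrow> average (F n) h < e"
      unfolding eventually_sequentially by blast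
    have "norm (average (F n) (indicator {s}) - 0) < e" if "n \<ge> N" for n
    proof -
      have "average (F n) (indicator {s}) \<le> average (F n) h"
        by (rule average_mono) (simp add: h_def indicator_def)
      moreover have "average (F n) (indicator {s}) \<ge> 0" by (rule average_nonneg) simp
      ultimately show ?thesis using N[OF that] by simp
    qed
    then show "\<exists>N. \<forall>n\<ge>N. norm (average (F n) (indicator {s}) - 0) < e" by blast
  qed
  have "(\<lambda>n. \<Sum>s\<in>S. average (F n) (indicator {s})) \<longlonglongrightarrow> (\<Sum>s\<in>S. 0)"
    by (intro tendsto_sum single)
  moreover have "(\<Sum>s\<in>S. average (F n) (indicator {s})) = average (F n) (indicator S)" for n
  proof -
    have "(\<lambda>y. \<Sum>s\<in>S. indicator {s} y) = (indicator S :: _ \<Rightarrow> real)"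
      using S by (auto simp: fun_eq_iff indicator_def)
    then show ?thesis by (simp add: average_sum[symmetric])
  qed
  ultimately show ?thesis by simp
qed

section \<open>Consequences of tightness\<close>

lemma average_indicator_eq_measure:
  assumes "finite F" "F \<noteq> {}"
  shows "measure (measure_pmf (pmf_of_set F)) A = average F (indicator A)"
  using assms by (simp add: measure_pmf_of_set average_def Int_def sum.If_cases indicator_def)

lemma compact_nat_bounded:
  fixes K :: "nat set"
  assumes "compact K"
  obtains L where "K \<subseteq> {..L}"
proof -
  have "\<exists>C'\<subseteq>K. finite C' \<and> K \<subseteq> (\<Union>c\<in>C'. {c})"
    by (rule compactE_image[OF assms, of K "\<lambda>c. {c}"]) (auto intro: Topological_Spaces.open_discrete)
  then have "finite K" by (metis UN_singleton finite_subset)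
  then show thesis using that[of "Max K"] by (simp add: subset_iff)
qed

lemma tight_gcd_bound:
  fixes F :: "nat \<Rightarrow> (int ^ 'd) set"
  assumes F: "folner F"
    and tight: "tight_family (\<lambda>n. distr (measure_pmf (pmf_of_set (F n))) (borel :: nat measure) vgcd)"
    and e: "e > 0"
  obtains L where "\<And>n. average (F n) (indicator {y. vgcd y \<le> L}) > 1 - e"
proof -
  obtain K where K: "compact K"
    "\<And>n. measure (distr (measure_pmf (pmf_of_set (F n))) (borel :: nat measure) vgcd) K > 1 - e"
    using tight e unfolding tight_family_def by blast
  obtain L where L: "K \<subseteq> {..L}" using compact_nat_bounded[OF K(1)] by blast
  show thesis
  proof (rule that)
    fix n
    have "measure (distr (measure_pmf (pmf_of_set (F n))) (borel :: nat measure) vgcd) K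
        = measure (measure_pmf (pmf_of_set (F n))) (vgcd -` K)"
      using K(1) by (subst measure_distr) (auto intro: borel_compact)
    also have "\<dots> \<le> measure (measure_pmf (pmf_of_set (F n))) {y. vgcd y \<le> L}"
      using L by (intro measure_pmf.finite_measure_mono) auto
    finally show "average (F n) (indicator {y. vgcd y \<le> L}) > 1 - e"
      using K(2)[of n] folner_finite[OF F] folner_nonempty[OF F]
      by (simp add: average_indicator_eq_measure)
  qed
qed

text \<open>
  In dimension one \<open>vgcd y\<close> is \<open>\<bar>y\<bar>\<close>, so tightness would keep half of the mass of all the \<open>F n\<close> on one
  finite set, against \<open>average_finite_set\<close>.
\<close>

lemma tight_imp_dim_ge_2:
  fixes F :: "nat \<Rightarrow> (int ^ 'd) set"
  assumes F: "folner F"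
    and tight: "tight_family (\<lambda>n. distr (measure_pmf (pmf_of_set (F n))) (borel :: nat measure) vgcd)"
  shows "CARD('d) \<ge> 2"
proof (rule ccontr)
  assume "\<not> CARD('d) \<ge> 2"
  moreover have "CARD('d) > 0" by simp
  ultimately have "CARD('d) = 1" by linarith
  then obtain j :: 'd where j: "UNIV = {j}" by (rule card_1_singletonE)
  obtain L where L: "\<And>n. average (F n) (indicator {y. vgcd y \<le> L}) > 1 - 1/2"
    using tight_gcd_bound[OF F tight, of "1/2"] by auto
  have "{y :: int ^ 'd. vgcd y \<le> L} \<subseteq> (\<lambda>a. \<chi> i. a) ` {- int L..int L}"
  proof
    fix y :: "int ^ 'd" assume y: "y \<in> {y. vgcd y \<le> L}"
    have ij: "i = j" for i using j by (metis UNIV_I singletonD)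
    have "range (\<lambda>i. y $ i) = {y $ j}" using arg_cong[OF j, of "image (vec_nth y)"] by simp
    then have "vgcd y = nat \<bar>y $ j\<bar>" by (simp add: vgcd_def)
    with y have "y $ j \<in> {- int L..int L}" by auto
    moreover have "y = (\<chi> i. y $ j)"
      by (subst vec_eq_iff) (metis ij vec_lambda_beta)
    ultimately show "y \<in> (\<lambda>a. \<chi> i. a) ` {- int L..int L}" by blast
  qed
  then have "finite {y :: int ^ 'd. vgcd y \<le> L}" by (rule finite_subset) simp
  from average_finite_set[OF F this]
  have "eventually (\<lambda>n. average (F n) (indicator {y. vgcd y \<le> L}) < 1/2) sequentially"
    by (rule order_tendstoD(2)) simp
  then obtain n where "average (F n) (indicator {y. vgcd y \<le> L}) < 1/2"
    using eventually_happens trivial_limit_sequentially by blast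
  with L[of n] show False by simp
qed

text \<open>
  Two gaps separate this from tightness: the translation by \<open>x\<close>, absorbed by the Folner
  property, and the value \<open>0\<close>, which occurs only at \<open>y = 0\<close>. The value \<open>0\<close> has to be excluded because
  every modulus divides it, so that truncation never leaves it unchanged.
\<close>

lemma tight_gcd_shift_bound:
  fixes F :: "nat \<Rightarrow> (int ^ 'd) set"
  assumes F: "folner F"
    and tight: "tight_family (\<lambda>n. distr (measure_pmf (pmf_of_set (F n))) (borel :: nat measure) vgcd)"
    and e: "e > 0"
  obtains L where "eventually (\<lambda>n. average (F n) (indicator {y. vgcd (x + y) \<notin> {1..L}}) < e) sequentially"
proof -
  obtain L where L: "\<And>n. average (F n) (indicator {y. vgcd y \<le> L}) > 1 - e/3"
    using tight_gcd_bound[OF F tight, of "e/3"] e by auto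
  let ?B = "{y :: int ^ 'd. vgcd y \<notin> {1..L}}"
  have ev0: "eventually (\<lambda>n. average (F n) (indicator {0}) < e/3) sequentially"
    by (rule order_tendstoD(2)[OF average_finite_set[OF F]]) (use e in auto)
  have "eventually (\<lambda>n. average (F n) (\<lambda>y. indicator ?B (x + y)) - average (F n) (indicator ?B) < e/3) sequentially"
    by (rule order_tendstoD(2)[OF average_shift[OF F, of "indicator ?B" 1 x]]) (use e in auto)
  with ev0 have "eventually (\<lambda>n. average (F n) (indicator {y. vgcd (x + y) \<notin> {1..L}}) < e) sequentially"
  proof eventually_elim
    case (elim n)
    have "average (F n) (indicator ?B) \<le> average (F n) (\<lambda>y. (1 - indicator {y. vgcd y \<le> L} y) + indicator {0} y)"
      by (rule average_mono) (auto simp: indicator_def Suc_le_eq vgcd_eq_0_iff)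
    also have "\<dots> = 1 - average (F n) (indicator {y. vgcd y \<le> L}) + average (F n) (indicator {0})"
      by (simp add: average_add average_diff average_const folner_finite[OF F] folner_nonempty[OF F])
    also have "\<dots> < e/3 + e/3" using L[of n] elim(1) by linarith
    finally have "average (F n) (\<lambda>y. indicator ?B (x + y)) < e" using elim(2) by linarith
    moreover have "(\<lambda>y. indicator ?B (x + y)) = (indicator {y. vgcd (x + y) \<notin> {1..L}} :: _ \<Rightarrow> real)"
      by (simp add: indicator_def fun_eq_iff)
    ultimately show ?case by simp
  qed
  then show thesis by (rule that)
qed


section \<open>The law of the random chains of cosets\<close>

text \<open>
  The coset of \<open>a\<close> modulo \<open>m\<int>\<^sup>d\<close>. Chains of cosets are described below by one representative \<open>r\<close>
  that serves all their levels up to a given one.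
\<close>

definition lcoset :: "nat \<Rightarrow> int ^ 'd \<Rightarrow> (int ^ 'd) set" where
  "lcoset m a = (\<lambda>z. a + int m *s z) ` UNIV"

lemma mem_lcoset_iff: "x \<in> lcoset m a \<longleftrightarrow> (\<forall>i. int m dvd x $ i - a $ i)"
proof
  assume "\<forall>i. int m dvd x $ i - a $ i"
  then have "\<forall>i. \<exists>k. x $ i - a $ i = int m * k" by (simp add: dvd_def)
  then obtain z where z: "\<And>i. x $ i - a $ i = int m * z i" by metis
  have "x = a + int m *s (\<chi> i. z i)"
    using z by (simp add: vec_eq_iff algebra_simps)
  then show "x \<in> lcoset m a" unfolding lcoset_def by blast
qed (auto simp: lcoset_def)

lemma lcoset_eq_iff: "lcoset m a = lcoset m b \<longleftrightarrow> (\<forall>i. int m dvd a $ i - b $ i)"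
proof
  assume "lcoset m a = lcoset m b"
  moreover have "a \<in> lcoset m a" by (simp add: mem_lcoset_iff)
  ultimately show "\<forall>i. int m dvd a $ i - b $ i" by (simp add: mem_lcoset_iff)
next
  assume ab: "\<forall>i. int m dvd a $ i - b $ i"
  have "int m dvd x $ i - a $ i \<longleftrightarrow> int m dvd x $ i - b $ i" for x i
    using dvd_add_left_iff[of "int m" "a $ i - b $ i" "x $ i - a $ i"] ab by simp
  then show "lcoset m a = lcoset m b" by (auto simp: mem_lcoset_iff)
qed

lemma lcoset_in_lattice_cosets: "lcoset m a \<in> lattice_cosets m"
  by (simp add: lcoset_def lattice_cosets_def)

lemma lattice_cosetsE:
  assumes "C \<in> lattice_cosets m" obtains a where "C = lcoset m a"
  using assms by (auto simp: lcoset_def lattice_cosets_def)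

text \<open>
  The cosets of \<open>p\<^sup>k\<^sup>+\<^sup>1\<int>\<^sup>d\<close> inside \<open>a + p\<^sup>k\<int>\<^sup>d\<close> are represented by \<open>a + p\<^sup>k s\<close>, where \<open>s\<close> runs through
  the residues modulo \<open>p\<close>.
\<close>

lemma card_subcosets:
  fixes a :: "int ^ 'd"
  assumes p: "p > 0"
  shows "card {C \<in> lattice_cosets (p ^ Suc k). C \<subseteq> lcoset (p ^ k) a} = p ^ CARD('d)"
proof -
  let ?f = "\<lambda>s. lcoset (p ^ Suc k) (a + int (p ^ k) *s s)"
  have "bij_betw ?f (residue_box p) {C \<in> lattice_cosets (p ^ Suc k). C \<subseteq> lcoset (p ^ k) a}"
  proof (rule bij_betwI')
    fix s t :: "int ^ 'd" assume st: "s \<in> residue_box p" "t \<in> residue_box p"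
    show "?f s = ?f t \<longleftrightarrow> s = t"
    proof
      assume "?f s = ?f t"
      then have "int (p ^ Suc k) dvd int (p ^ k) * s $ i - int (p ^ k) * t $ i" for i
        by (simp add: lcoset_eq_iff)
      then have "int (p ^ k) * int p dvd int (p ^ k) * (s $ i - t $ i)" for i
        by (simp add: algebra_simps)
      then have "int p dvd s $ i - t $ i" for i using p by simp
      then show "s = t" by (rule residue_box_eqI[OF st])
    qed simp
  next
    fix s :: "int ^ 'd"
    have "?f s \<subseteq> lcoset (p ^ k) a"
    proof
      fix x assume "x \<in> ?f s"
      then have "int (p ^ k) * int p dvd x $ i - (a $ i + int (p ^ k) * s $ i)" for i
        by (simp add: mem_lcoset_iff mult.commute)
      then have "int (p ^ k) dvd x $ i - (a $ i + int (p ^ k) * s $ i)" for i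
        using dvd_mult_left by blast
      then have "int (p ^ k) dvd (x $ i - (a $ i + int (p ^ k) * s $ i)) + int (p ^ k) * s $ i" for i
        by (intro dvd_add) auto
      then show "x \<in> lcoset (p ^ k) a" by (simp add: mem_lcoset_iff)
    qed
    then show "?f s \<in> {C \<in> lattice_cosets (p ^ Suc k). C \<subseteq> lcoset (p ^ k) a}"
      using lcoset_in_lattice_cosets by blast
  next
    fix C assume "C \<in> {C \<in> lattice_cosets (p ^ Suc k). C \<subseteq> lcoset (p ^ k) a}"
    then obtain b where C: "C = lcoset (p ^ Suc k) b" "C \<subseteq> lcoset (p ^ k) a"
      using lattice_cosetsE by blast
    have "b \<in> C" by (simp add: C(1) mem_lcoset_iff)
    then have "b \<in> lcoset (p ^ k) a" using C(2) by blast
    then obtain z where z: "b = a + int (p ^ k) *s z" by (auto simp: lcoset_def)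
    have "int (p ^ Suc k) dvd b $ i - (a + int (p ^ k) *s vmod z p) $ i" for i
    proof -
      have "int p dvd z $ i - z $ i mod int p" by (simp add: mod_eq_dvd_iff[symmetric])
      then have "int (p ^ k) * int p dvd int (p ^ k) * (z $ i - z $ i mod int p)"
        by (rule mult_dvd_mono[OF dvd_refl])
      then show ?thesis by (simp add: z vmod_def algebra_simps)
    qed
    then have "C = ?f (vmod z p)" unfolding C(1) lcoset_eq_iff by blast
    then show "\<exists>s\<in>residue_box p. C = ?f s" using vmod_in_residue_box[OF p] by blast
  qed
  from bij_betw_same_card[OF this] show ?thesis by (simp add: card_residue_box)
qed

lemma coset_kernel_singleton:
  fixes r :: "int ^ 'd"
  assumes p: "p > 0" and W: "n > 0 \<Longrightarrow> W (n - 1) = lcoset (p ^ (n - 1)) r"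
  shows "emeasure (coset_kernel p n W) {lcoset (p ^ n) r}
    = ennreal (if n = 0 then 1 else 1 / real (p ^ CARD('d)))"
proof -
  let ?A = "{C \<in> lattice_cosets (p ^ n). n = 0 \<or> C \<subseteq> W (n - 1)}"
  have fin: "finite ?A"
    by (rule finite_subset[OF _ lattice_cosets_finite[of "p ^ n"]]) (use p in auto)
  have mem: "lcoset (p ^ n) r \<in> ?A"
  proof (cases n)
    case (Suc k)
    have "lcoset (p ^ n) r \<subseteq> lcoset (p ^ k) r"
    proof
      fix x assume "x \<in> lcoset (p ^ n) r"
      then have "\<forall>i. int (p ^ n) dvd x $ i - r $ i" by (simp add: mem_lcoset_iff)
      moreover have "int (p ^ k) dvd int (p ^ n)" by (simp add: Suc)
      ultimately show "x \<in> lcoset (p ^ k) r" unfolding mem_lcoset_iff by (meson dvd_trans)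
    qed
    then show ?thesis using W Suc by (simp add: lcoset_in_lattice_cosets)
  qed (simp add: lcoset_in_lattice_cosets)
  have card: "card ?A = (if n = 0 then 1 else p ^ CARD('d))"
  proof (cases n)
    case 0
    have "lattice_cosets 1 = {UNIV :: (int ^ 'd) set}"
    proof (intro equalityI subsetI)
      fix C :: "(int ^ 'd) set" assume "C \<in> lattice_cosets 1"
      then obtain a where "C = lcoset 1 a" by (rule lattice_cosetsE)
      then show "C \<in> {UNIV}" by (auto simp: mem_lcoset_iff)
    next
      fix C :: "(int ^ 'd) set" assume "C \<in> {UNIV}"
      then have "C = lcoset 1 0" by (auto simp: mem_lcoset_iff)
      then show "C \<in> lattice_cosets 1" by (simp add: lcoset_in_lattice_cosets)
    qed
    then show ?thesis using 0 by simp
  next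
    case (Suc k)
    then show ?thesis using W card_subcosets[OF p, of k r] by simp
  qed
  have "emeasure (coset_kernel p n W) {lcoset (p ^ n) r}
      = emeasure (coset_space p n) (?A \<inter> {lcoset (p ^ n) r}) / emeasure (coset_space p n) ?A"
    unfolding coset_kernel_def
    by (rule emeasure_uniform_measure) (auto simp: coset_space_def lcoset_in_lattice_cosets)
  also have "?A \<inter> {lcoset (p ^ n) r} = {lcoset (p ^ n) r}" using mem by blast
  also have "emeasure (coset_space p n) {lcoset (p ^ n) r} = 1"
    by (simp add: coset_space_def lcoset_in_lattice_cosets emeasure_count_space)
  also have "emeasure (coset_space p n) ?A = of_nat (card ?A)"
    using fin unfolding coset_space_def by (subst emeasure_count_space_finite) auto
  also have "1 / of_nat (card ?A) = ennreal (if n = 0 then 1 else 1 / real (p ^ CARD('d)))"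
  proof -
    have "1 / of_nat k = ennreal (1 / real k)" if "k > 0" for k :: nat
      using divide_ennreal[of 1 "real k"] that by (simp add: ennreal_of_nat_eq_real_of_nat)
    from this[of "card ?A"] p show ?thesis unfolding card by (auto split: if_splits)
  qed
  finally show ?thesis .
qed

text \<open>
  Each of the \<open>n\<close> refinement steps chooses among \<open>p\<^sup>d\<close> subcosets. There are \<open>p\<^sup>n\<^sup>d\<close> classes of \<open>r\<close> modulo
  \<open>p\<^sup>n\<close>, so these events exhaust the space up to a null set; this is how the nestedness of the
  chain is recovered later on.
\<close>

lemma coset_chain_law:
  fixes r :: "int ^ 'd" and n :: nat
  assumes p: "p > 0"
  defines "E \<equiv> {W \<in> space (coset_chain p). \<forall>i\<le>n. W i = lcoset (p ^ i) r}"
  shows "E \<in> sets (coset_chain p)"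
    and "emeasure (coset_chain p) E = ennreal ((1 / real (p ^ CARD('d))) ^ n)"
proof -
  interpret Ionescu_Tulcea "coset_kernel p :: nat \<Rightarrow> (nat \<Rightarrow> (int ^ 'd) set) \<Rightarrow> _" "coset_space p"
    by (rule Ionescu_Tulcea_coset[OF p])
  let ?M = "coset_space p :: nat \<Rightarrow> (int ^ 'd) set measure"
  define A where "A n = PiE {0..<n} (\<lambda>i. {lcoset (p ^ i) r})" for n
  have A: "A n \<in> sets (PiM {0..<n} ?M)" for n
    unfolding A_def by (intro sets_PiM_I_finite) (auto simp: coset_space_def lcoset_in_lattice_cosets)
  \<comment> \<open>The factor below is \<open>1\<close> for \<open>n = 0\<close>, since \<open>W 0\<close> is deterministic; hence \<open>n + 1\<close>
    coordinates have only \<open>n\<close> factors \<open>p\<^sup>-\<^sup>d\<close>.\<close>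
  let ?c = "1 / real (p ^ CARD('d))"
  have undef: "(\<lambda>_. undefined) \<in> space (PiM {0..<0} ?M)" by (simp add: space_PiM)
  have step: "emeasure (C 0 (Suc n) (\<lambda>_. undefined)) (A (Suc n))
      = ennreal (if n = 0 then 1 else ?c) * emeasure (C 0 n (\<lambda>_. undefined)) (A n)" for n
  proof -
    have eP: "emeasure (eP n \<omega>) (A (Suc n)) = ennreal (if n = 0 then 1 else ?c) * indicator (A n) \<omega>"
      if \<omega>: "\<omega> \<in> space (PiM {0..<n} ?M)" for \<omega>
    proof -
      have pre: "(\<lambda>x. fun_upd \<omega> n x) -` A (Suc n) \<inter> space (?M n) = (if \<omega> \<in> A n then {lcoset (p ^ n) r} else {})"
      proof -
        have ext: "\<omega> \<in> extensional {0..<n}" using \<omega> by (simp add: space_PiM PiE_iff)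
        then have "fun_upd \<omega> n x \<in> extensional {0..<Suc n}" for x
          by (simp add: extensional_def)
        with ext have "fun_upd \<omega> n x \<in> A (Suc n) \<longleftrightarrow> \<omega> \<in> A n \<and> x = lcoset (p ^ n) r" for x
          by (auto simp: A_def PiE_iff less_Suc_eq)
        moreover have "lcoset (p ^ n) r \<in> space (?M n)"
          by (simp add: coset_space_def lcoset_in_lattice_cosets)
        ultimately show ?thesis by (auto simp del: fun_upd_apply)
      qed
      have ker: "emeasure (coset_kernel p n \<omega>) {lcoset (p ^ n) r} = ennreal (if n = 0 then 1 else ?c)"
        if "\<omega> \<in> A n"
        by (rule coset_kernel_singleton[OF p]) (use that in \<open>auto simp: A_def PiE_iff\<close>)
      show ?thesis
        unfolding emeasure_eP[OF \<omega> A] pre using ker by (simp add: indicator_def)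
    qed
    have "emeasure (C 0 (Suc n) (\<lambda>_. undefined)) (A (Suc n))
        = (\<integral>\<^sup>+\<omega>. emeasure (eP n \<omega>) (A (Suc n)) \<partial>C 0 n (\<lambda>_. undefined))"
      unfolding C.simps add_0
    proof (rule emeasure_bind[OF _ _ A])
      show "space (C 0 n (\<lambda>_. undefined)) \<noteq> {}"
        by (rule prob_space.not_empty[OF prob_space_C[OF undef]])
      have "sets (C 0 n (\<lambda>_. undefined)) = sets (PiM {0..<n} ?M)"
        using sets_C[OF undef, of n] by simp
      then show "eP n \<in> measurable (C 0 n (\<lambda>_. undefined)) (subprob_algebra (PiM {0..<Suc n} ?M))"
        using measurable_eP[of n] measurable_cong_sets by blast
    qed
    also have "\<dots> = (\<integral>\<^sup>+\<omega>. ennreal (if n = 0 then 1 else ?c) * indicator (A n) \<omega> \<partial>C 0 n (\<lambda>_. undefined))"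
      by (intro nn_integral_cong eP) (use space_C[OF undef, of n] in simp)
    also have "\<dots> = ennreal (if n = 0 then 1 else ?c) * emeasure (C 0 n (\<lambda>_. undefined)) (A n)"
      using sets_C[OF undef, of n] A[of n] by (subst nn_integral_cmult_indicator) auto
    finally show ?thesis .
  qed
  have law: "emeasure (C 0 (Suc n) (\<lambda>_. undefined)) (A (Suc n)) = ennreal (?c ^ n)" for n
  proof (induction n)
    case 0
    have "emeasure (C 0 0 (\<lambda>_. undefined)) (A 0) = 1"
      using A[of 0] by (simp add: A_def)
    then show ?case using step[of 0] by simp
  next
    case (Suc n)
    show ?case unfolding step[of "Suc n"] Suc by (subst ennreal_mult[symmetric]) simp_all
  qed
  have sp: "space (coset_chain p) = space (PiM UNIV ?M)"
    by (rule sets_eq_imp_space_eq[OF sets_coset_chain[OF p]])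
  have E: "E = prod_emb UNIV ?M {0..<Suc n} (A (Suc n))"
    unfolding E_def sp prod_emb_def A_def by (auto simp: space_PiM PiE_iff less_Suc_eq_le)
  show "E \<in> sets (coset_chain p)"
    unfolding E sets_coset_chain[OF p] A_def
    by (rule sets_PiM_I) (auto simp: A_def coset_space_def lcoset_in_lattice_cosets)
  have "emeasure (coset_chain p) E = emeasure (CI {0..<Suc n}) (A (Suc n))"
    unfolding coset_chain_def E by (rule lim) (use A in auto)
  also have "\<dots> = emeasure (C 0 (Suc n) (\<lambda>_. undefined)) (prod_emb {0..<Suc n} ?M {0..<Suc n} (A (Suc n)))"
    by (rule emeasure_CI) (use A in auto)
  also have "prod_emb {0..<Suc n} ?M {0..<Suc n} (A (Suc n)) = A (Suc n)"
    using sets.sets_into_space[OF A[of "Suc n"]] by (intro prod_emb_id) (simp add: space_PiM)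
  finally show "emeasure (coset_chain p) E = ennreal ((1 / real (p ^ CARD('d))) ^ n)"
    by (simp only: law)
qed

definition level_modulus :: "nat \<Rightarrow> nat" where
  "level_modulus T = (\<Prod>p | prime p \<and> p \<le> T. p ^ T)"

lemma finite_primes_le: "finite {p :: nat. prime p \<and> p \<le> T}"
  by (rule finite_subset[of _ "{..T}"]) auto

lemma level_modulus_pos: "level_modulus T > 0"
  unfolding level_modulus_def by (intro prod_pos) (auto intro: prime_gt_0_nat)

text \<open>
  The sign is chosen so that \<open>x \<in> W p i\<close> means \<open>p\<^sup>i\<close> divides \<open>x + r\<close>, in analogy with \<open>x + Y\<close>.
\<close>

definition level_event :: "nat \<Rightarrow> int ^ 'd \<Rightarrow> (nat \<Rightarrow> nat \<Rightarrow> (int ^ 'd) set) set" where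
  "level_event T r = {W \<in> space coset_chains.
     \<forall>p\<in>{p. prime p \<and> p \<le> T}. \<forall>i\<le>T. W p i = lcoset (p ^ i) (- r)}"

text \<open>
  The factors for the single primes are \<open>p\<^sup>-\<^sup>d\<^sup>T\<close>, and they multiply up to the reciprocal of the number
  of residues modulo \<open>level_modulus T\<close>.
\<close>

lemma level_event_law:
  fixes r :: "int ^ 'd"
  shows "level_event T r \<in> sets coset_chains"
    and "measure coset_chains (level_event T r) = 1 / real (level_modulus T ^ CARD('d))"
proof -
  let ?P = "{p :: nat. prime p \<and> p \<le> T}"
  let ?E = "\<lambda>p. {W \<in> space (coset_chain p). \<forall>i\<le>T. W i = lcoset (p ^ i) (- r)}"
  have pos: "p > 0" if "prime p" for p :: nat using that by (rule prime_gt_0_nat)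
  have eq: "level_event T r = prod_emb {p. prime p} coset_chain ?P (PiE ?P ?E)"
    unfolding level_event_def prod_emb_def coset_chains_def
    by (auto simp: space_PiM PiE_iff extensional_def)
  show "level_event T r \<in> sets coset_chains"
    unfolding eq coset_chains_def
  proof (rule sets_PiM_I)
    show "\<forall>p\<in>?P. ?E p \<in> sets (coset_chain p)"
      by (intro ballI coset_chain_law(1) pos) simp
  qed (use finite_primes_le in auto)
  have "emeasure coset_chains (level_event T r) = (\<Prod>p\<in>?P. emeasure (coset_chain p) (?E p))"
    unfolding eq coset_chains_def
  proof (rule emeasure_PiM_emb)
    show "prob_space (coset_chain p :: (nat \<Rightarrow> (int ^ 'd) set) measure)" if "p \<in> {p. prime p}" for p
      using that by (intro prob_space_coset_chain pos) simp
    show "?E p \<in> sets (coset_chain p)" if "p \<in> ?P" for p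
      using that by (intro coset_chain_law(1) pos) simp
  qed (use finite_primes_le in auto)
  also have "\<dots> = (\<Prod>p\<in>?P. ennreal ((1 / real (p ^ CARD('d))) ^ T))"
    by (intro prod.cong refl coset_chain_law(2)) (auto intro: pos)
  also have "\<dots> = ennreal (\<Prod>p\<in>?P. (1 / real (p ^ CARD('d))) ^ T)"
    by (rule prod_ennreal) simp
  also have "(\<Prod>p\<in>?P. (1 / real (p ^ CARD('d))) ^ T) = 1 / real (level_modulus T ^ CARD('d))"
  proof -
    have "(1 / real (p ^ CARD('d))) ^ T = 1 / real ((p ^ T) ^ CARD('d))" for p
      by (simp add: power_one_over power_mult[symmetric] mult.commute)
    then show ?thesis by (simp add: level_modulus_def prod_dividef prod_power_distrib)
  qed
  finally show "measure coset_chains (level_event T r) = 1 / real (level_modulus T ^ CARD('d))"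
    by (simp add: measure_def)
qed


section \<open>The random profinite vector and the limit law\<close>

lemma prime_power_dvd_level_modulus:
  assumes "prime p" "p \<le> T" "i \<le> T"
  shows "p ^ i dvd level_modulus T"
proof -
  have "p ^ T dvd level_modulus T"
    unfolding level_modulus_def by (rule dvd_prodI) (use finite_primes_le assms in auto)
  then show ?thesis using le_imp_power_dvd[OF assms(3)] dvd_trans by blast
qed

lemma level_modulus_dvdI:
  assumes "\<And>p. prime p \<Longrightarrow> p \<le> T \<Longrightarrow> int (p ^ T) dvd a"
  shows "int (level_modulus T) dvd a"
proof -
  have "(\<Prod>p\<in>P. int (p ^ T)) dvd a" if "finite P" "P \<subseteq> {p. prime p \<and> p \<le> T}" for P :: "nat set"
    using that
  proof (induction P rule: finite_induct)
    case (insert q P)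
    have "coprime (int (q ^ T)) (int (p ^ T))" if "p \<in> P" for p
    proof -
      have "p \<noteq> q" "prime p" "prime q" using insert that by auto
      then have "coprime (q ^ T) (p ^ T)" by (simp add: primes_coprime)
      then show ?thesis by (simp only: coprime_int_iff)
    qed
    then have "coprime (int (q ^ T)) (\<Prod>p\<in>P. int (p ^ T))" by (rule prod_coprime_right)
    moreover have "int (q ^ T) dvd a" using insert.prems by (intro assms) auto
    ultimately have "int (q ^ T) * (\<Prod>p\<in>P. int (p ^ T)) dvd a"
      using insert by (intro divides_mult) auto
    then show ?case using insert by simp
  qed simp
  from this[OF finite_primes_le[of T] order_refl] show ?thesis
    by (simp add: level_modulus_def)
qed

lemma level_modulus_dvd_Suc: "level_modulus T dvd level_modulus (Suc T)"
proof -
  have "int (level_modulus T) dvd int (level_modulus (Suc T))"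
    by (rule level_modulus_dvdI) (metis int_dvd_int_iff prime_power_dvd_level_modulus le_SucI order_refl)
  then show ?thesis by (simp only: int_dvd_int_iff)
qed

lemma level_event_mem_iff:
  assumes "W \<in> level_event T r" "prime p" "p \<le> T" "i \<le> T"
  shows "x \<in> W p i \<longleftrightarrow> p ^ i dvd vgcd (x + r)"
proof -
  have "W p i = lcoset (p ^ i) (- r)" using assms by (auto simp: level_event_def)
  then show ?thesis by (simp add: mem_lcoset_iff dvd_vgcd_iff)
qed

text \<open>
  Representatives at different levels are compatible; with \<open>T = T'\<close>, a representative is unique
  modulo \<open>level_modulus T\<close>. This is the injectivity part of the Chinese remainder theorem.
  Existence of representatives follows by counting, in \<open>AE_profinite\<close>.
\<close>

lemma level_event_unique:
  assumes r: "W \<in> level_event T r" and s: "W \<in> level_event T' s" and le: "T \<le> T'"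
  shows "int (level_modulus T) dvd r $ i - s $ i"
proof (rule level_modulus_dvdI)
  fix p :: nat assume p: "prime p" "p \<le> T"
  have "lcoset (p ^ T) (- r) = W p T" "lcoset (p ^ T) (- s) = W p T"
    using r s p le by (auto simp: level_event_def)
  then have "lcoset (p ^ T) (- s) = lcoset (p ^ T) (- r)" by simp
  then have "int (p ^ T) dvd (- s) $ i - (- r) $ i" unfolding lcoset_eq_iff by blast
  then show "int (p ^ T) dvd r $ i - s $ i" by simp
qed

lemma level_event_disjoint:
  "disjoint_family_on (level_event T) (residue_box (level_modulus T))"
  unfolding disjoint_family_on_def
proof (intro ballI impI)
  fix r s :: "int ^ 'd"
  assume rs: "r \<in> residue_box (level_modulus T)" "s \<in> residue_box (level_modulus T)" "r \<noteq> s"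
  show "level_event T r \<inter> level_event T s = {}"
  proof (rule ccontr)
    assume "level_event T r \<inter> level_event T s \<noteq> {}"
    then obtain W where "W \<in> level_event T r" "W \<in> level_event T s" by blast
    then have "r = s" using level_event_unique residue_box_eqI[OF rs(1,2)] by blast
    with rs(3) show False by simp
  qed
qed

lemma measure_level_events:
  fixes S :: "(int ^ 'd) set"
  assumes "S \<subseteq> residue_box (level_modulus T)"
  shows "measure coset_chains (\<Union>r\<in>S. level_event T r) = average (residue_box (level_modulus T)) (indicator S)"
proof -
  interpret prob_space "coset_chains :: (nat \<Rightarrow> nat \<Rightarrow> (int ^ 'd) set) measure"
    by (rule prob_space_coset_chains)
  have fin: "finite S" using assms finite_residue_box finite_subset by blast
  have "prob (\<Union>r\<in>S. level_event T r) = (\<Sum>r\<in>S. prob (level_event T r))"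
    using fin level_event_law(1) disjoint_family_on_mono[OF assms level_event_disjoint]
    by (intro finite_measure_finite_Union) auto
  also have "\<dots> = real (card S) / real (level_modulus T ^ CARD('d))"
    by (simp add: level_event_law(2))
  also have "real (card S) = (\<Sum>r\<in>residue_box (level_modulus T). indicator S r)"
  proof -
    have "(\<Sum>r\<in>residue_box (level_modulus T). indicator S r) = (\<Sum>r\<in>S. 1 :: real)"
      using assms finite_residue_box by (intro sum.mono_neutral_cong_right) auto
    then show ?thesis by simp
  qed
  finally show ?thesis by (simp add: average_def card_residue_box)
qed

text \<open>
  For every \<open>T\<close> one vector represents the chains up to level \<open>T\<close>. By \<open>level_event_unique\<close> these
  vectors are compatible, so together they are a point of the profinite completion of \<open>\<int>\<^sup>d\<close>.
\<close>

definition profinite :: "(nat \<Rightarrow> nat \<Rightarrow> (int ^ 'd) set) \<Rightarrow> bool" where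
  "profinite W \<longleftrightarrow> (\<forall>T. \<exists>r\<in>residue_box (level_modulus T). W \<in> level_event T r)"

text \<open>
  There are \<open>(level_modulus T)\<^sup>d\<close> disjoint events of equal probability \<open>(level_modulus T)\<^sup>-\<^sup>d\<close>.
\<close>

lemma AE_profinite: "AE W in coset_chains. profinite (W :: nat \<Rightarrow> nat \<Rightarrow> (int ^ 'd) set)"
  unfolding profinite_def AE_all_countable
proof
  fix T
  interpret prob_space "coset_chains :: (nat \<Rightarrow> nat \<Rightarrow> (int ^ 'd) set) measure"
    by (rule prob_space_coset_chains)
  let ?R = "residue_box (level_modulus T) :: (int ^ 'd) set"
  have "average ?R (indicator ?R) = average ?R (\<lambda>_. 1)" by (simp add: average_def)
  also have "\<dots> = 1"
  proof (rule average_const[OF finite_residue_box])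
    show "?R \<noteq> {}" using vmod_in_residue_box[OF level_modulus_pos] by blast
  qed
  finally have "prob (\<Union>r\<in>?R. level_event T r) = 1" by (simp add: measure_level_events)
  from AE_prob_1[OF this] show "AE W in coset_chains. \<exists>r\<in>?R. W \<in> level_event T r" by simp
qed

definition residue_at :: "nat \<Rightarrow> (nat \<Rightarrow> nat \<Rightarrow> (int ^ 'd) set) \<Rightarrow> int ^ 'd" where
  "residue_at T W = (SOME r. r \<in> residue_box (level_modulus T) \<and> W \<in> level_event T r)"

lemma residue_at:
  assumes "profinite W"
  shows "residue_at T W \<in> residue_box (level_modulus T)" "W \<in> level_event T (residue_at T W)"
proof -
  have "\<exists>r. r \<in> residue_box (level_modulus T) \<and> W \<in> level_event T r"
    using assms by (auto simp: profinite_def)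
  from someI_ex[OF this]
  show "residue_at T W \<in> residue_box (level_modulus T)" "W \<in> level_event T (residue_at T W)"
    by (simp_all add: residue_at_def)
qed

lemma residue_at_unique:
  assumes "profinite W" "r \<in> residue_box (level_modulus T)"
  shows "W \<in> level_event T r \<longleftrightarrow> r = residue_at T W"
  using residue_at[OF assms(1), of T] residue_box_eqI[OF assms(2) residue_at(1)[OF assms(1)]]
    level_event_unique[of W T r T "residue_at T W"] by blast

text \<open>
  The random variable \<open>h (residue_at T W)\<close>, written as a simple function: this form is measurable
  on the whole space, whereas \<open>residue_at\<close> is meaningful only on the almost sure event
  \<open>profinite W\<close>.
\<close>

definition level_sum :: "nat \<Rightarrow> (int ^ 'd \<Rightarrow> real) \<Rightarrow> (nat \<Rightarrow> nat \<Rightarrow> (int ^ 'd) set) \<Rightarrow> real" where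
  "level_sum T h W = (\<Sum>r\<in>residue_box (level_modulus T). h r * indicator (level_event T r) W)"

lemma level_sum_eq:
  assumes "profinite W" shows "level_sum T h W = h (residue_at T W)"
proof -
  have "level_sum T h W = (\<Sum>r\<in>residue_box (level_modulus T). if r = residue_at T W then h r else 0)"
    unfolding level_sum_def
    by (intro sum.cong refl) (simp add: residue_at_unique[OF assms] indicator_def)
  also have "\<dots> = h (residue_at T W)"
    by (simp add: finite_residue_box residue_at[OF assms])
  finally show ?thesis .
qed

lemma borel_measurable_level_sum: "level_sum T h \<in> borel_measurable coset_chains"
  unfolding level_sum_def[abs_def]
  by (intro borel_measurable_sum borel_measurable_times borel_measurable_const borel_measurable_indicator
        level_event_law(1))

lemma integral_level_sum:
  fixes h :: "int ^ 'd \<Rightarrow> real"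
  shows "(\<integral>W. level_sum T h W \<partial>coset_chains) = average (residue_box (level_modulus T)) h"
proof -
  interpret prob_space "coset_chains :: (nat \<Rightarrow> nat \<Rightarrow> (int ^ 'd) set) measure"
    by (rule prob_space_coset_chains)
  have int: "integrable coset_chains (\<lambda>W. h r * indicator (level_event T r) W)" for r
    using level_event_law(1)[of T r] by (intro integrable_mult_right integrable_real_indicator) (auto simp: emeasure_eq_measure)
  have "(\<integral>W. level_sum T h W \<partial>coset_chains)
      = (\<Sum>r\<in>residue_box (level_modulus T). h r * prob (level_event T r))"
    unfolding level_sum_def by (subst Bochner_Integration.integral_sum[OF int])
      (simp add: level_event_law(1) sets.Int_space_eq2)
  then show ?thesis
    by (simp add: level_event_law(2) average_def card_residue_box sum_divide_distrib)
qed

definition level_gcd :: "int ^ 'd \<Rightarrow> nat \<Rightarrow> (nat \<Rightarrow> nat \<Rightarrow> (int ^ 'd) set) \<Rightarrow> nat" where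
  "level_gcd x T W = gcd (level_modulus T) (vgcd (x + residue_at T W))"

lemma level_gcd_pos: "level_gcd x T W > 0"
  using level_modulus_pos[of T] by (simp add: level_gcd_def)

text \<open>
  By compatibility \<open>residue_at (Suc T) W\<close> may replace \<open>residue_at T W\<close> in the definition, after which
  only the modulus changes.
\<close>

lemma level_gcd_dvd_Suc:
  assumes "profinite W"
  shows "level_gcd x T W dvd level_gcd x (Suc T) W"
proof -
  have "level_gcd x T W = gcd (level_modulus T) (vgcd (x + residue_at (Suc T) W))"
    unfolding level_gcd_def
    by (rule lattice_periodicD[OF lattice_periodic_gcd])
       (rule level_event_unique[OF residue_at(2)[OF assms] residue_at(2)[OF assms]], simp)
  also have "\<dots> dvd level_gcd x (Suc T) W"
    unfolding level_gcd_def by (intro gcd_mono level_modulus_dvd_Suc dvd_refl)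
  finally show ?thesis .
qed

lemma level_gcd_mono:
  assumes "profinite W" "T \<le> T'"
  shows "level_gcd x T W \<le> level_gcd x T' W"
  by (rule lift_Suc_mono_le[OF _ assms(2)]) (intro dvd_imp_le level_gcd_dvd_Suc[OF assms(1)] level_gcd_pos)

lemma prime_power_dvd_level_gcd:
  assumes "profinite W" "prime p" "p \<le> T" "i \<le> T"
  shows "p ^ i dvd level_gcd x T W \<longleftrightarrow> x \<in> W p i"
  using prime_power_dvd_level_modulus[OF assms(2-4)]
    level_event_mem_iff[OF residue_at(2)[OF assms(1)] assms(2-4)]
  by (simp add: level_gcd_def)

text \<open>
  The partial products over \<open>p \<le> n\<close> divide \<open>g\<close> and are equal to it from \<open>n = g\<close> on.
\<close>

lemma prime_power_prod_multiplicity: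
  fixes g :: nat
  assumes g: "g > 0" and v: "\<And>p. prime p \<Longrightarrow> v p = enat (multiplicity p g)"
  shows "prime_power_prod v = enat g"
proof -
  have part: "(\<Prod>p | prime p \<and> p \<le> n. enat_power p (v p))
      = enat (\<Prod>p | prime p \<and> p \<le> n. p ^ multiplicity p g)" for n
  proof -
    have "(\<Prod>p | prime p \<and> p \<le> n. enat_power p (v p))
        = (\<Prod>p | prime p \<and> p \<le> n. of_nat (p ^ multiplicity p g))"
      by (intro prod.cong refl) (simp add: v enat_power_def of_nat_eq_enat)
    also have "\<dots> = of_nat (\<Prod>p | prime p \<and> p \<le> n. p ^ multiplicity p g)"
      by (simp only: of_nat_prod)
    finally show ?thesis by (simp only: of_nat_eq_enat)
  qed
  have full: "(\<Prod>p | prime p \<and> p \<le> n. p ^ multiplicity p g) = g" if "n \<ge> g" for n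
  proof -
    have "p \<le> n" if "p \<in> prime_factors g" for p
      using dvd_imp_le[of p g] that g \<open>n \<ge> g\<close> by (auto simp: prime_factors_dvd)
    then have "(\<Prod>p | prime p \<and> p \<le> n. p ^ multiplicity p g) = (\<Prod>p\<in>prime_factors g. p ^ multiplicity p g)"
      using g by (intro prod.mono_neutral_right finite_primes_le)
        (auto simp: prime_factors_multiplicity in_prime_factors_iff not_dvd_imp_multiplicity_0)
    then show ?thesis using prod_prime_factors[of g] g by simp
  qed
  have le: "(\<Prod>p | prime p \<and> p \<le> n. p ^ multiplicity p g) \<le> g" for n
  proof -
    have "(\<Prod>p | prime p \<and> p \<le> n. p ^ multiplicity p g) \<le> (\<Prod>p | prime p \<and> p \<le> max n g. p ^ multiplicity p g)"
      by (intro dvd_imp_le prod_dvd_prod_subset finite_primes_le prod_pos)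
         (auto intro: prime_gt_0_nat)
    then show ?thesis using full[of "max n g"] by simp
  qed
  have "(SUP n. \<Prod>p | prime p \<and> p \<le> n. enat_power p (v p)) = enat g"
    unfolding part by (intro antisym SUP_least) (auto simp: le intro: SUP_upper2[of g] simp: full)
  moreover have "v 2 \<noteq> \<infinity>" by (simp add: v)
  ultimately show ?thesis unfolding prime_power_prod_def using two_is_prime_nat by auto
qed

definition limit_gcd :: "int ^ 'd \<Rightarrow> (nat \<Rightarrow> nat \<Rightarrow> (int ^ 'd) set) \<Rightarrow> nat" where
  "limit_gcd x W = the_enat (prime_power_prod (\<lambda>p. chain_val (W p) x))"

text \<open>
  A bounded divisibility chain stabilises at some \<open>g > 0\<close>. Reading \<open>p\<^sup>i dvd g\<close> at a level
  beyond \<open>p\<close> and \<open>i\<close> shows that \<open>x \<in> W p i\<close> holds exactly for \<open>i \<le> multiplicity p g\<close>, so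
  all the exponents \<open>V\<^sub>p(x)\<close> are finite and are those of \<open>g\<close>.
\<close>

lemma level_gcd_eventually_limit:
  assumes W: "profinite W" and L: "\<And>T. level_gcd x T W \<le> L"
  shows "eventually (\<lambda>T. level_gcd x T W = limit_gcd x W) sequentially"
proof -
  have "finite (range (\<lambda>T. level_gcd x T W))"
    by (rule finite_subset[of _ "{..L}"]) (use L in auto)
  from Max_in[OF this] obtain T0 where T0: "Max (range (\<lambda>T. level_gcd x T W)) = level_gcd x T0 W" by auto
  define g where "g = level_gcd x T0 W"
  have g: "level_gcd x T W = g" if "T \<ge> T0" for T
  proof (rule antisym)
    show "level_gcd x T W \<le> g"
      unfolding g_def T0[symmetric] by (rule Max_ge) (use \<open>finite (range (\<lambda>T. level_gcd x T W))\<close> in auto)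
    show "g \<le> level_gcd x T W" unfolding g_def by (rule level_gcd_mono[OF W that])
  qed
  have g0: "g > 0" unfolding g_def by (rule level_gcd_pos)
  have "chain_val (W p) x = enat (multiplicity p g)" if p: "prime p" for p
  proof -
    have "x \<in> W p i \<longleftrightarrow> i \<le> multiplicity p g" for i
    proof -
      let ?T = "max T0 (max p i)"
      have "x \<in> W p i \<longleftrightarrow> p ^ i dvd level_gcd x ?T W"
        by (rule prime_power_dvd_level_gcd[OF W p, symmetric]) auto
      also have "\<dots> \<longleftrightarrow> p ^ i dvd g" by (simp add: g)
      also have "\<dots> \<longleftrightarrow> i \<le> multiplicity p g"
        using g0 p by (intro power_dvd_iff_le_multiplicity) (auto dest: prime_gt_1_nat)
      finally show ?thesis .
    qed
    then have "chain_val (W p) x = Sup {enat i | i. i \<le> multiplicity p g}"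
      by (simp add: chain_val_def)
    also have "\<dots> = enat (multiplicity p g)"
      by (intro antisym Sup_least Sup_upper) auto
    finally show ?thesis .
  qed
  then have "limit_gcd x W = g"
    unfolding limit_gcd_def using prime_power_prod_multiplicity[OF g0] by simp
  then show ?thesis
    unfolding eventually_sequentially using g by blast
qed

text \<open>
  The events that \<open>level_gcd x T\<close> exceeds \<open>L\<close> increase with \<open>T\<close>, so a bound on their probabilities
  that is uniform in \<open>T\<close> passes to their union over \<open>T\<close>.
\<close>

lemma AE_level_gcd_bounded:
  fixes x :: "int ^ 'd"
  assumes tight: "\<And>e. e > 0 \<Longrightarrow> \<exists>L. \<forall>T. average (residue_box (level_modulus T))
      (indicator {r. gcd (level_modulus T) (vgcd (x + r)) > L}) \<le> e"
  shows "AE W in coset_chains. \<exists>L. \<forall>T. level_gcd x T W \<le> L"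
proof -
  interpret prob_space "coset_chains :: (nat \<Rightarrow> nat \<Rightarrow> (int ^ 'd) set) measure"
    by (rule prob_space_coset_chains)
  define S where "S L T = {r \<in> residue_box (level_modulus T). gcd (level_modulus T) (vgcd (x + r)) > L}" for L T
  define B where "B L T = (\<Union>r\<in>S L T. level_event T r)" for L T
  have fin: "finite (S L T)" for L T
    by (rule finite_subset[OF _ finite_residue_box]) (auto simp: S_def)
  have B: "B L T \<in> events" for L T
    unfolding B_def by (intro sets.finite_UN fin level_event_law(1))
  have mem: "W \<in> B L T \<longleftrightarrow> level_gcd x T W > L" if "profinite W" for W L T
    using residue_at[OF that, of T] residue_at_unique[OF that] by (auto simp: B_def S_def level_gcd_def)
  define N where "N = (\<Inter>L. \<Union>T. B L T)"
  have N: "N \<in> events" unfolding N_def by (rule sets.countable_INT') (auto intro: B)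
  have "prob N \<le> e" if e: "e > 0" for e
  proof -
    obtain L where L: "\<And>T. average (residue_box (level_modulus T))
      (indicator {r. gcd (level_modulus T) (vgcd (x + r)) > L}) \<le> e" using tight[OF e] by blast
    have "prob (B L T) \<le> e" for T
    proof -
      have "prob (B L T) = average (residue_box (level_modulus T)) (indicator (S L T))"
        unfolding B_def by (rule measure_level_events) (auto simp: S_def)
      also have "\<dots> = average (residue_box (level_modulus T))
          (indicator {r. gcd (level_modulus T) (vgcd (x + r)) > L})"
        unfolding average_def S_def by (intro arg_cong2[where f = "(/)"] sum.cong) (auto simp: indicator_def)
      finally show ?thesis using L[of T] by simp
    qed
    moreover have "prob (\<Union>T\<le>n. B L T) = prob (B L n)" for n
    proof (rule finite_measure_eq_AE)
      show "AE W in coset_chains. W \<in> (\<Union>T\<le>n. B L T) \<longleftrightarrow> W \<in> B L n"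
        using AE_profinite
      proof eventually_elim
        case (elim W)
        then show ?case using level_gcd_mono[OF elim] by (auto simp: mem intro: less_le_trans)
      qed
    qed (auto intro: B)
    ultimately have "prob (\<Union>T\<le>n. B L T) \<le> e" for n by simp
    moreover have "(\<lambda>n. prob (\<Union>T\<le>n. B L T)) \<longlonglongrightarrow> prob (\<Union>n. \<Union>T\<le>n. B L T)"
      by (rule finite_Lim_measure_incseq) (auto simp: incseq_def intro: B le_trans)
    ultimately have "prob (\<Union>n. \<Union>T\<le>n. B L T) \<le> e"
      by (intro LIMSEQ_le_const2) auto
    moreover have "prob N \<le> prob (\<Union>n. \<Union>T\<le>n. B L T)"
      by (rule finite_measure_mono) (auto simp: N_def intro!: sets.countable_UN B)
    ultimately show ?thesis by simp
  qed
  then have "prob N \<le> 0" by (rule field_le_epsilon) simp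
  then have "prob N = 0" by (simp add: measure_le_0_iff)
  then have "AE W in coset_chains. W \<notin> N"
    using N by (intro AE_not_in null_setsI) (simp_all add: emeasure_eq_measure)
  with AE_profinite show ?thesis
  proof eventually_elim
    case (elim W)
    then show ?case using mem[OF elim(1)] by (auto simp: N_def not_less)
  qed
qed

lemma the_enat_coordinatewise_measurable: "(\<lambda>f :: int ^ 'd \<Rightarrow> enat. \<lambda>x. the_enat (f x)) \<in> borel_measurable mu_inf_gcd_ext"
proof (rule measurable_coordinatewise_then_product)
  fix x :: "int ^ 'd"
  have "(\<lambda>f. f x) \<in> measurable mu_inf_gcd_ext (count_space UNIV)"
    unfolding mu_inf_gcd_ext_def by simp
  from measurable_compose[OF this, of the_enat borel]
  show "(\<lambda>f. the_enat (f x)) \<in> borel_measurable mu_inf_gcd_ext" by simp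
qed

lemma limit_gcd_measurable:
  "(\<lambda>W x. limit_gcd x W) \<in> borel_measurable (coset_chains :: (nat \<Rightarrow> nat \<Rightarrow> (int ^ 'd) set) measure)"
proof (rule measurable_coordinatewise_then_product)
  fix x :: "int ^ 'd"
  show "limit_gcd x \<in> borel_measurable coset_chains"
    unfolding limit_gcd_def[abs_def]
    using measurable_compose[OF measurable_prime_power_prod[of x], of the_enat borel] by simp
qed

lemma mu_inf_gcd_eq_distr:
  "(mu_inf_gcd :: (int ^ 'd \<Rightarrow> nat) measure) = distr coset_chains borel (\<lambda>W x. limit_gcd x W)"
proof -
  have "(\<lambda>W x. prime_power_prod (\<lambda>p. chain_val (W p) (x :: int ^ 'd)))
      \<in> measurable coset_chains (PiM UNIV (\<lambda>_. count_space UNIV))"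
    by (intro measurable_PiM_single') (auto intro: measurable_prime_power_prod)
  moreover have "(\<lambda>f :: int ^ 'd \<Rightarrow> enat. \<lambda>x. the_enat (f x)) \<in> borel_measurable (PiM UNIV (\<lambda>_. count_space UNIV))"
    using the_enat_coordinatewise_measurable unfolding mu_inf_gcd_ext_def by simp
  ultimately show ?thesis
    unfolding mu_inf_gcd_def mu_inf_gcd_ext_def by (simp add: distr_distr comp_def limit_gcd_def)
qed

text \<open>
  Functions of finitely many sites form the test class: on \<open>\<nat>\<close>-valued configurations they are
  automatically continuous, hence measurable.
\<close>

definition depends_on :: "'i set \<Rightarrow> (('i \<Rightarrow> 'a) \<Rightarrow> 'b) \<Rightarrow> bool" where
  "depends_on A f \<longleftrightarrow> (\<forall>\<omega> \<omega>'. (\<forall>x\<in>A. \<omega> x = \<omega>' x) \<longrightarrow> f \<omega> = f \<omega>')"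

lemma depends_onD: "depends_on A f \<Longrightarrow> (\<And>x. x \<in> A \<Longrightarrow> \<omega> x = \<omega>' x) \<Longrightarrow> f \<omega> = f \<omega>'"
  by (simp add: depends_on_def)

lemma open_cylinder:
  fixes \<omega> :: "'i \<Rightarrow> nat"
  assumes "finite A"
  shows "open {\<omega>'. \<forall>x\<in>A. \<omega>' x = \<omega> x}"
  using product_topology_basis'[of A "\<lambda>x. {\<omega> x}" "\<lambda>x. x"] assms
  by (simp add: Topological_Spaces.open_discrete)

lemma depends_on_continuous:
  fixes f :: "('i \<Rightarrow> nat) \<Rightarrow> 'b::topological_space"
  assumes A: "finite A" and f: "depends_on A f"
  shows "continuous_on UNIV f"
  unfolding continuous_on_open_vimage[OF open_UNIV]
proof (intro allI impI)
  fix B :: "'b set"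
  have "\<exists>U. open U \<and> \<omega> \<in> U \<and> U \<subseteq> f -` B" if \<omega>: "\<omega> \<in> f -` B" for \<omega>
  proof (intro exI conjI)
    show "open {\<omega>'. \<forall>x\<in>A. \<omega>' x = \<omega> x}" by (rule open_cylinder[OF A])
    show "{\<omega>'. \<forall>x\<in>A. \<omega>' x = \<omega> x} \<subseteq> f -` B"
    proof
      fix \<omega>' assume "\<omega>' \<in> {\<omega>'. \<forall>x\<in>A. \<omega>' x = \<omega> x}"
      then have "f \<omega>' = f \<omega>" by (intro depends_onD[OF f]) simp
      with \<omega> show "\<omega>' \<in> f -` B" by simp
    qed
  qed simp
  then have "open (f -` B)" by (subst open_subopen) (rule ballI)
  then show "open (f -` B \<inter> UNIV)" by simp
qed

text \<open>
  On finitely many sites the truncated configuration of the limit object is almost surely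
  eventually equal to the untruncated one; dominated convergence does the rest.
\<close>

lemma level_averages_tendsto:
  fixes f :: "(int ^ 'd \<Rightarrow> nat) \<Rightarrow> real"
  assumes tight: "\<And>x :: int ^ 'd. AE W in coset_chains. \<exists>L. \<forall>T. level_gcd x T W \<le> L"
    and A: "finite A" and f: "depends_on A f" and B: "\<And>\<omega>. \<bar>f \<omega>\<bar> \<le> B"
  shows "(\<lambda>T. average (residue_box (level_modulus T)) (\<lambda>r. f (\<lambda>x. gcd (level_modulus T) (vgcd (x + r)))))
    \<longlonglongrightarrow> (\<integral>\<omega>. f \<omega> \<partial>mu_inf_gcd)"
proof -
  interpret prob_space "coset_chains :: (nat \<Rightarrow> nat \<Rightarrow> (int ^ 'd) set) measure"
    by (rule prob_space_coset_chains)
  let ?h = "\<lambda>T r. f (\<lambda>x. gcd (level_modulus T) (vgcd (x + r)))"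
  have fm: "f \<in> borel_measurable borel"
    by (rule borel_measurable_continuous_onI[OF depends_on_continuous[OF A f]])
  have lev: "level_sum T (?h T) W = f (\<lambda>x. level_gcd x T W)" if "profinite W" for T W
    using level_sum_eq[OF that, of T "?h T"] by (simp add: level_gcd_def)
  have "(\<lambda>T. \<integral>W. level_sum T (?h T) W \<partial>coset_chains) \<longlonglongrightarrow> (\<integral>W. f (\<lambda>x. limit_gcd x W) \<partial>coset_chains)"
  proof (rule integral_dominated_convergence[where w = "\<lambda>_. B"])
    show "(\<lambda>W. f (\<lambda>x. limit_gcd x W)) \<in> borel_measurable coset_chains"
      by (rule measurable_compose[OF limit_gcd_measurable fm])
    show "level_sum T (?h T) \<in> borel_measurable coset_chains" for T
      by (rule borel_measurable_level_sum)
    show "AE W in coset_chains. norm (level_sum T (?h T) W) \<le> B" for T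
      using AE_profinite by eventually_elim (simp add: lev B)
    have "AE W in coset_chains. \<forall>x\<in>A. \<exists>L. \<forall>T. level_gcd x T W \<le> L"
      using tight A by (intro AE_finite_allI) auto
    with AE_profinite show "AE W in coset_chains. (\<lambda>T. level_sum T (?h T) W) \<longlonglongrightarrow> f (\<lambda>x. limit_gcd x W)"
    proof eventually_elim
      case (elim W)
      have "eventually (\<lambda>T. \<forall>x\<in>A. level_gcd x T W = limit_gcd x W) sequentially"
        using elim level_gcd_eventually_limit by (intro eventually_ball_finite A) blast
      then have "eventually (\<lambda>T. level_sum T (?h T) W = f (\<lambda>x. limit_gcd x W)) sequentially"
      proof eventually_elim
        case (elim T)
        then show ?case unfolding lev[OF \<open>profinite W\<close>] by (intro depends_onD[OF f]) simp
      qed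
      then show ?case by (rule tendsto_eventually)
    qed
  qed simp
  then show ?thesis
    by (simp add: integral_level_sum mu_inf_gcd_eq_distr integral_distr[OF limit_gcd_measurable fm])
qed


section \<open>Convergence on finitely many sites\<close>

text \<open>
  An exponent in \<open>v\<close> is smaller than the prime power that it produces, hence smaller than \<open>T\<close>.
\<close>

lemma dvd_level_modulus:
  assumes "v \<in> {1..T}" shows "v dvd level_modulus T"
proof (rule multiplicity_le_imp_dvd)
  show "v \<noteq> 0" using assms by simp
  fix p :: nat assume p: "prime p"
  have "p ^ multiplicity p v \<le> v" using assms by (intro dvd_imp_le multiplicity_dvd) simp
  moreover have "multiplicity p v < p ^ multiplicity p v"
    using prime_gt_1_nat[OF p] by (simp add: power_gt_expt)
  ultimately have le: "multiplicity p v \<le> T" using assms by simp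
  show "multiplicity p v \<le> multiplicity p (level_modulus T)"
  proof (cases "p \<le> T")
    case True
    show ?thesis
      by (intro multiplicity_geI prime_power_dvd_level_modulus[OF p True le])
         (use level_modulus_pos[of T] p in \<open>auto dest: prime_gt_1_nat\<close>)
  next
    case False
    then have "\<not> p dvd v" using assms dvd_imp_le[of p v] by auto
    then show ?thesis by (simp add: not_dvd_imp_multiplicity_0)
  qed
qed

text \<open>
  For fixed \<open>T\<close> the left-hand side is a limit of frequencies along \<open>F n\<close>, and
  \<open>gcd (level_modulus T) v \<le> v\<close> unless \<open>v = 0\<close>. This transfers tightness from \<open>F\<close> to the limit
  object, with a bound \<open>L\<close> independent of \<open>T\<close>.
\<close>

lemma tight_level_bound:
  fixes F :: "nat \<Rightarrow> (int ^ 'd) set" and x :: "int ^ 'd"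
  assumes F: "folner F"
    and tight: "tight_family (\<lambda>n. distr (measure_pmf (pmf_of_set (F n))) (borel :: nat measure) vgcd)"
    and e: "e > 0"
  shows "\<exists>L. \<forall>T. average (residue_box (level_modulus T))
      (indicator {r. gcd (level_modulus T) (vgcd (x + r)) > L}) \<le> e"
proof -
  obtain L where L: "eventually (\<lambda>n. average (F n) (indicator {y. vgcd (x + y) \<notin> {1..L}}) < e) sequentially"
    using tight_gcd_shift_bound[OF F tight e] by blast
  have "average (residue_box (level_modulus T))
      (indicator {r. gcd (level_modulus T) (vgcd (x + r)) > L}) \<le> e" for T
  proof (rule tendsto_upperbound[OF average_periodic[OF F level_modulus_pos]])
    show "lattice_periodic (level_modulus T)
        (indicator {r. gcd (level_modulus T) (vgcd (x + r)) > L} :: int ^ 'd \<Rightarrow> real)"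
      using lattice_periodic_gcd_configuration[of "level_modulus T" "\<lambda>\<omega>. of_bool (\<omega> x > L) :: real"]
      by (simp add: indicator_def[abs_def])
    show "eventually (\<lambda>n. average (F n) (indicator {r. gcd (level_modulus T) (vgcd (x + r)) > L}) \<le> e) sequentially"
      using L
    proof eventually_elim
      case (elim n)
      have small: "\<not> L < gcd (level_modulus T) v" if "Suc 0 \<le> v" "v \<le> L" for v
      proof -
        have "gcd (level_modulus T) v \<le> v" using that by (intro dvd_imp_le) auto
        also have "v \<le> L" by fact
        finally show ?thesis by simp
      qed
      have "average (F n) (indicator {r. gcd (level_modulus T) (vgcd (x + r)) > L})
          \<le> average (F n) (indicator {y. vgcd (x + y) \<notin> {1..L}})"
      proof (rule average_mono)
        fix y :: "int ^ 'd"
        show "indicator {r. gcd (level_modulus T) (vgcd (x + r)) > L} y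
            \<le> (indicator {y. vgcd (x + y) \<notin> {1..L}} y :: real)"
          using small[of "vgcd (x + y)"] by (auto simp: indicator_def)
      qed
      with elim show ?case by simp
    qed
  qed simp
  then show ?thesis by blast
qed

lemma average_truncation_error:
  fixes F :: "(int ^ 'd) set"
  assumes A: "finite A" and f: "depends_on A f" and B: "\<And>\<omega>. \<bar>f \<omega>\<bar> \<le> (B :: real)"
    and T: "\<And>x. x \<in> A \<Longrightarrow> L x \<le> T"
  shows "\<bar>average F (\<lambda>y. f (\<lambda>x. vgcd (x + y)))
      - average F (\<lambda>y. f (\<lambda>x. gcd (level_modulus T) (vgcd (x + y))))\<bar>
    \<le> 2 * B * (\<Sum>x\<in>A. average F (indicator {y. vgcd (x + y) \<notin> {1..L x}}))"
proof -
  let ?D = "\<lambda>y. f (\<lambda>x. vgcd (x + y)) - f (\<lambda>x. gcd (level_modulus T) (vgcd (x + y)))"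
  let ?bad = "\<lambda>x. indicator {y. vgcd (x + y) \<notin> {1..L x}} :: int ^ 'd \<Rightarrow> real"
  have B0: "B \<ge> 0" using B[of undefined] by linarith
  have "\<bar>?D y\<bar> \<le> 2 * B * (\<Sum>x\<in>A. ?bad x y)" for y
  proof (cases "\<forall>x\<in>A. vgcd (x + y) \<in> {1..L x}")
    case True
    have "gcd (level_modulus T) (vgcd (x + y)) = vgcd (x + y)" if "x \<in> A" for x
    proof -
      have "vgcd (x + y) \<in> {1..T}" using True T[OF that] that by fastforce
      from dvd_level_modulus[OF this] show ?thesis by (simp add: gcd_proj2_iff)
    qed
    then have "f (\<lambda>x. vgcd (x + y)) = f (\<lambda>x. gcd (level_modulus T) (vgcd (x + y)))"
      by (intro depends_onD[OF f]) simp
    moreover have "0 \<le> (\<Sum>x\<in>A. ?bad x y)" by (intro sum_nonneg) simp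
    ultimately show ?thesis using B0 by simp
  next
    case False
    then obtain x where x: "x \<in> A" "vgcd (x + y) \<notin> {1..L x}" by blast
    have "1 = ?bad x y" using x(2) by simp
    also have "\<dots> \<le> (\<Sum>x\<in>A. ?bad x y)" by (rule member_le_sum[OF x(1)]) (simp_all add: A)
    finally have "2 * B * 1 \<le> 2 * B * (\<Sum>x\<in>A. ?bad x y)" using B0 by (intro mult_left_mono) auto
    moreover have "\<bar>?D y\<bar> \<le> 2 * B"
      using B[of "\<lambda>x. vgcd (x + y)"] B[of "\<lambda>x. gcd (level_modulus T) (vgcd (x + y))"] by linarith
    ultimately show ?thesis by simp
  qed
  then have "average F (\<lambda>y. \<bar>?D y\<bar>) \<le> average F (\<lambda>y. 2 * B * (\<Sum>x\<in>A. ?bad x y))"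
    by (rule average_mono)
  then have "\<bar>average F ?D\<bar> \<le> average F (\<lambda>y. 2 * B * (\<Sum>x\<in>A. ?bad x y))"
    by (rule order_trans[OF abs_average_le])
  also have "\<dots> = 2 * B * (\<Sum>x\<in>A. average F (?bad x))"
    by (simp only: average_cmult average_sum)
  finally show ?thesis by (simp only: average_diff)
qed

text \<open>
  Three errors are added: the truncation error along \<open>F n\<close>, the equidistribution error
  modulo \<open>level_modulus T\<close>, and the distance of the truncated to the full limit law. The level \<open>T\<close>
  is fixed before \<open>n\<close> tends to infinity.
\<close>

lemma averages_tendsto_finite_sites:
  fixes F :: "nat \<Rightarrow> (int ^ 'd) set" and f :: "(int ^ 'd \<Rightarrow> nat) \<Rightarrow> real"
  assumes F: "folner F"
    and tight: "tight_family (\<lambda>n. distr (measure_pmf (pmf_of_set (F n))) (borel :: nat measure) vgcd)"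
    and A: "finite A" and f: "depends_on A f" and B: "\<And>\<omega>. \<bar>f \<omega>\<bar> \<le> B"
  shows "(\<lambda>n. average (F n) (\<lambda>y. f (\<lambda>x. vgcd (x + y)))) \<longlonglongrightarrow> (\<integral>\<omega>. f \<omega> \<partial>mu_inf_gcd)"
proof (rule tendstoI)
  fix e :: real assume e: "e > 0"
  \<comment> \<open>At most \<open>card A\<close> sites, each contributing at most \<open>2 B \<delta>\<close>, must stay below \<open>e / 3\<close>;
    the additions of \<open>1\<close> avoid division by zero.\<close>
  define \<delta> where "\<delta> = e / (3 * (2 * B + 1) * (real (card A) + 1))"
  have B0: "B \<ge> 0" using B[of undefined] by linarith
  then have \<delta>: "\<delta> > 0" using e unfolding \<delta>_def by (intro divide_pos_pos mult_pos_pos) auto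
  have "\<forall>x. \<exists>L. eventually (\<lambda>n. average (F n) (indicator {y. vgcd (x + y) \<notin> {1..L}}) < \<delta>) sequentially"
    using tight_gcd_shift_bound[OF F tight \<delta>] by metis
  then obtain L where L: "\<And>x. eventually (\<lambda>n. average (F n) (indicator {y. vgcd (x + y) \<notin> {1..L x}}) < \<delta>) sequentially"
    by metis
  let ?a = "\<lambda>T. average (residue_box (level_modulus T)) (\<lambda>r. f (\<lambda>x. gcd (level_modulus T) (vgcd (x + r))))"
  let ?I = "\<integral>\<omega>. f \<omega> \<partial>mu_inf_gcd"
  have "?a \<longlonglongrightarrow> ?I"
    by (rule level_averages_tendsto[OF AE_level_gcd_bounded[OF tight_level_bound[OF F tight]] A f B])
  then have "eventually (\<lambda>T. dist (?a T) ?I < e / 3) sequentially"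
    using e by (intro tendstoD) auto
  moreover have "eventually (\<lambda>T. \<forall>x\<in>A. L x \<le> T) sequentially"
    by (intro eventually_ball_finite A ballI eventually_ge_at_top)
  ultimately have "eventually (\<lambda>T. dist (?a T) ?I < e / 3 \<and> (\<forall>x\<in>A. L x \<le> T)) sequentially"
    by eventually_elim simp
  then obtain T where T: "dist (?a T) ?I < e / 3" "\<And>x. x \<in> A \<Longrightarrow> L x \<le> T"
    using eventually_happens trivial_limit_sequentially by blast
  let ?b = "\<lambda>n. average (F n) (\<lambda>r. f (\<lambda>x. gcd (level_modulus T) (vgcd (x + r))))"
  have "?b \<longlonglongrightarrow> ?a T"
    by (rule average_periodic[OF F level_modulus_pos lattice_periodic_gcd_configuration])
  then have "eventually (\<lambda>n. dist (?b n) (?a T) < e / 3) sequentially"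
    using e by (intro tendstoD) auto
  moreover have "eventually (\<lambda>n. \<forall>x\<in>A. average (F n) (indicator {y. vgcd (x + y) \<notin> {1..L x}}) < \<delta>) sequentially"
    by (intro eventually_ball_finite A ballI L)
  ultimately show "eventually (\<lambda>n. dist (average (F n) (\<lambda>y. f (\<lambda>x. vgcd (x + y)))) ?I < e) sequentially"
  proof eventually_elim
    case (elim n)
    have "(\<Sum>x\<in>A. average (F n) (indicator {y. vgcd (x + y) \<notin> {1..L x}})) \<le> (\<Sum>x\<in>A. \<delta>)"
      using elim(2) by (intro sum_mono) (simp add: less_imp_le)
    also have "\<dots> \<le> (real (card A) + 1) * \<delta>" using \<delta> by simp
    finally have "2 * B * (\<Sum>x\<in>A. average (F n) (indicator {y. vgcd (x + y) \<notin> {1..L x}}))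
        \<le> (2 * B + 1) * ((real (card A) + 1) * \<delta>)"
      using B0 \<delta> by (intro mult_mono) (auto intro!: sum_nonneg average_nonneg)
    also have "\<dots> = e / 3" using B0 by (simp add: \<delta>_def field_simps add_nonneg_eq_0_iff)
    finally have "2 * B * (\<Sum>x\<in>A. average (F n) (indicator {y. vgcd (x + y) \<notin> {1..L x}})) \<le> e / 3" .
    with average_truncation_error[OF A f B T(2), of "\<lambda>x. x" "F n"]
    have "dist (average (F n) (\<lambda>y. f (\<lambda>x. vgcd (x + y)))) (?b n) \<le> e / 3"
      unfolding dist_real_def by linarith
    with elim(1) T(1) show ?case unfolding dist_real_def by linarith
  qed
qed

section \<open>Weak convergence from finitely many sites\<close>

lemma open_contains_cylinder:
  fixes U :: "('i \<Rightarrow> nat) set"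
  assumes "open U" "\<omega> \<in> U"
  obtains A where "finite A" "{\<omega>'. \<forall>x\<in>A. \<omega>' x = \<omega> x} \<subseteq> U"
proof -
  have "openin (product_topology (\<lambda>i. euclidean) UNIV) U"
    using assms(1) by (simp add: euclidean_product_topology)
  from product_topology_open_contains_basis[OF this assms(2)] obtain X where
    X: "\<omega> \<in> PiE UNIV X" "finite {i. X i \<noteq> UNIV}" "PiE UNIV X \<subseteq> U" by auto
  show thesis
  proof (rule that[OF X(2)])
    have "\<omega>' \<in> PiE UNIV X" if "\<forall>x\<in>{i. X i \<noteq> UNIV}. \<omega>' x = \<omega> x" for \<omega>'
    proof -
      have "\<omega>' i \<in> X i" for i
        using X(1) that by (cases "X i = UNIV") (auto simp: PiE_iff)
      then show ?thesis by (simp add: PiE_iff)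
    qed
    then show "{\<omega>'. \<forall>x\<in>{i. X i \<noteq> UNIV}. \<omega>' x = \<omega> x} \<subseteq> U" using X(3) by blast
  qed
qed

text \<open>
  The infimum of \<open>f\<close> over the cylinder of all configurations that agree with \<open>\<omega>\<close> at the
  sites numbered at most \<open>k\<close>. It converges to \<open>f \<omega>\<close> by continuity, but not uniformly, since \<open>\<nat>\<close> is not compact;
  one-sidedness \<open>g k \<le> f\<close> is what makes up for this below.
\<close>

lemma lower_cylinder_approximation:
  fixes f :: "('i::countable \<Rightarrow> nat) \<Rightarrow> real"
  assumes cont: "continuous_on UNIV f" and B: "\<And>\<omega>. \<bar>f \<omega>\<bar> \<le> B"
  obtains A g where "\<And>k :: nat. finite (A k)" "\<And>k. depends_on (A k) (g k)"
    "\<And>k \<omega>. \<bar>g k \<omega>\<bar> \<le> B" "\<And>k \<omega>. g k \<omega> \<le> f \<omega>" "\<And>\<omega>. (\<lambda>k. g k \<omega>) \<longlonglongrightarrow> f \<omega>"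
proof -
  define A :: "nat \<Rightarrow> 'i set" where "A k = {x. to_nat x \<le> k}" for k
  define Z where "Z k \<omega> = {\<omega>'. \<forall>x\<in>A k. \<omega>' x = \<omega> x}" for k and \<omega> :: "'i \<Rightarrow> nat"
  define g where "g k \<omega> = Inf (f ` Z k \<omega>)" for k \<omega>
  have Z: "\<omega> \<in> Z k \<omega>" for k \<omega> by (simp add: Z_def)
  have lb: "- B \<le> f \<omega>" for \<omega> using B[of \<omega>] by linarith
  have bdd: "bdd_below (f ` S)" for S by (rule bdd_belowI2[of _ "- B"]) (rule lb)
  have le: "g k \<omega> \<le> f \<omega>" for k \<omega>
    unfolding g_def by (rule cINF_lower[OF bdd Z])
  have ge: "c \<le> g k \<omega>" if "\<And>\<omega>'. \<omega>' \<in> Z k \<omega> \<Longrightarrow> c \<le> f \<omega>'" for c k \<omega>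
    unfolding g_def using Z that by (intro cINF_greatest) auto
  show thesis
  proof (rule that)
    show "finite (A k)" for k
      unfolding A_def by (rule finite_imageD[of to_nat]) (auto intro: finite_subset[of _ "{..k}"] inj_on_subset[OF inj_to_nat])
    show "depends_on (A k) (g k)" for k
      unfolding depends_on_def
    proof (intro allI impI)
      fix \<omega> \<omega>' :: "'i \<Rightarrow> nat" assume "\<forall>x\<in>A k. \<omega> x = \<omega>' x"
      then have "Z k \<omega> = Z k \<omega>'" by (simp add: Z_def)
      then show "g k \<omega> = g k \<omega>'" by (simp add: g_def)
    qed
    show "\<bar>g k \<omega>\<bar> \<le> B" for k \<omega>
      using le[of k \<omega>] B[of \<omega>] ge[of k \<omega> "- B"] lb by (auto simp: abs_le_iff)
    show "g k \<omega> \<le> f \<omega>" for k \<omega> by (rule le)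
    show "(\<lambda>k. g k \<omega>) \<longlonglongrightarrow> f \<omega>" for \<omega>
    proof (rule tendstoI)
      fix e :: real assume e: "e > 0"
      have "open (f -` ball (f \<omega>) (e / 2))"
        using cont by (intro open_vimage) auto
      moreover have "\<omega> \<in> f -` ball (f \<omega>) (e / 2)" using e by simp
      ultimately obtain J where J: "finite J"
        "{\<omega>'. \<forall>x\<in>J. \<omega>' x = \<omega> x} \<subseteq> f -` ball (f \<omega>) (e / 2)"
        by (rule open_contains_cylinder)
      have "eventually (\<lambda>k. \<forall>x\<in>J. to_nat x \<le> k) sequentially"
        by (intro eventually_ball_finite J(1) ballI eventually_ge_at_top)
      then show "eventually (\<lambda>k. dist (g k \<omega>) (f \<omega>) < e) sequentially"
      proof eventually_elim
        case (elim k)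
        have "f \<omega> - e / 2 \<le> g k \<omega>"
        proof (rule ge)
          fix \<omega>' assume "\<omega>' \<in> Z k \<omega>"
          then have "\<omega>' \<in> {\<omega>'. \<forall>x\<in>J. \<omega>' x = \<omega> x}"
            using elim by (simp add: Z_def A_def)
          then have "\<omega>' \<in> f -` ball (f \<omega>) (e / 2)"
            by (rule subsetD[OF J(2)])
          then have "\<bar>f \<omega> - f \<omega>'\<bar> < e / 2" by (simp add: dist_real_def)
          then show "f \<omega> - e / 2 \<le> f \<omega>'" by linarith
        qed
        with le[of k \<omega>] e show ?case by (simp add: dist_real_def)
      qed
    qed
  qed
qed

text \<open>
  The lower approximations give \<open>liminf \<integral> f dM\<^sub>n \<ge> \<integral> f dN\<close> by
  monotonicity of the integral, and the same bound for \<open>- f\<close> gives the converse.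
\<close>

lemma weakly_convergesI_finite_sites:
  fixes M :: "nat \<Rightarrow> ('i::countable \<Rightarrow> nat) measure"
  assumes M: "\<And>n. prob_space (M n)" "\<And>n. sets (M n) = sets borel"
    and N: "prob_space N" "sets N = sets borel"
    and conv: "\<And>A f B. finite A \<Longrightarrow> depends_on A f \<Longrightarrow> (\<And>\<omega>. \<bar>f \<omega>\<bar> \<le> (B :: real)) \<Longrightarrow>
      (\<lambda>n. \<integral>\<omega>. f \<omega> \<partial>M n) \<longlonglongrightarrow> (\<integral>\<omega>. f \<omega> \<partial>N)"
  shows "weakly_converges M N"
proof -
  have meas: "f \<in> borel_measurable K"
    if "continuous_on UNIV f" "sets K = sets borel" for f :: "('i \<Rightarrow> nat) \<Rightarrow> real" and K
    using borel_measurable_continuous_onI[OF that(1)] that(2) measurable_cong_sets by blast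
  have int: "integrable K f"
    if "prob_space K" "f \<in> borel_measurable K" "\<And>\<omega>. \<bar>f \<omega>\<bar> \<le> B"
    for f :: "('i \<Rightarrow> nat) \<Rightarrow> real" and K B
  proof -
    interpret prob_space K by fact
    show ?thesis using that by (intro integrable_const_bound[of _ B]) auto
  qed
  have lower: "eventually (\<lambda>n. (\<integral>\<omega>. f \<omega> \<partial>N) - e < (\<integral>\<omega>. f \<omega> \<partial>M n)) sequentially"
    if cont: "continuous_on UNIV f" and B: "\<And>\<omega>. \<bar>f \<omega>\<bar> \<le> B" and e: "e > 0"
    for f :: "('i \<Rightarrow> nat) \<Rightarrow> real" and B e
  proof -
    interpret N: prob_space N by fact
    obtain A g where A: "\<And>k :: nat. finite (A k)" and g: "\<And>k. depends_on (A k) (g k)"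
      "\<And>k \<omega>. \<bar>g k \<omega>\<bar> \<le> B" "\<And>k \<omega>. g k \<omega> \<le> f \<omega>" "\<And>\<omega>. (\<lambda>k. g k \<omega>) \<longlonglongrightarrow> f \<omega>"
      using lower_cylinder_approximation[OF cont B] by blast
    have gm: "g k \<in> borel_measurable K" if "sets K = sets borel" for k K
      by (rule meas[OF depends_on_continuous[OF A g(1)] that])
    have "(\<lambda>k. \<integral>\<omega>. g k \<omega> \<partial>N) \<longlonglongrightarrow> (\<integral>\<omega>. f \<omega> \<partial>N)"
      by (rule integral_dominated_convergence[where w = "\<lambda>_. B"])
         (use g N gm meas[OF cont N(2)] in auto)
    then have "eventually (\<lambda>k. (\<integral>\<omega>. f \<omega> \<partial>N) - e < (\<integral>\<omega>. g k \<omega> \<partial>N)) sequentially"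
      using e by (intro order_tendstoD(1)) auto
    then obtain k where k: "(\<integral>\<omega>. f \<omega> \<partial>N) - e < (\<integral>\<omega>. g k \<omega> \<partial>N)"
      using eventually_happens trivial_limit_sequentially by blast
    have "eventually (\<lambda>n. (\<integral>\<omega>. f \<omega> \<partial>N) - e < (\<integral>\<omega>. g k \<omega> \<partial>M n)) sequentially"
      by (rule order_tendstoD(1)[OF conv[OF A g(1) g(2)] k])
    then show ?thesis
    proof eventually_elim
      case (elim n)
      have "(\<integral>\<omega>. g k \<omega> \<partial>M n) \<le> (\<integral>\<omega>. f \<omega> \<partial>M n)"
        by (intro integral_mono int[OF M(1), where B = B] gm meas[OF cont] M(2) g B)
      with elim show ?case by simp
    qed
  qed
  have "(\<lambda>n. \<integral>\<omega>. f \<omega> \<partial>M n) \<longlonglongrightarrow> (\<integral>\<omega>. f \<omega> \<partial>N)"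
    if cont: "continuous_on UNIV f" and bdd: "bounded (range f)" for f :: "('i \<Rightarrow> nat) \<Rightarrow> real"
  proof (rule tendstoI)
    fix e :: real assume e: "e > 0"
    obtain B where B: "\<And>\<omega>. \<bar>f \<omega>\<bar> \<le> B" using bdd by (auto simp: bounded_iff)
    have "eventually (\<lambda>n. (\<integral>\<omega>. f \<omega> \<partial>N) - e < (\<integral>\<omega>. f \<omega> \<partial>M n)) sequentially"
      by (rule lower[OF cont B e])
    moreover have "eventually (\<lambda>n. (\<integral>\<omega>. - f \<omega> \<partial>N) - e < (\<integral>\<omega>. - f \<omega> \<partial>M n)) sequentially"
      by (rule lower[of _ B]) (use cont B e in \<open>auto intro: continuous_on_minus\<close>)
    ultimately show "eventually (\<lambda>n. dist (\<integral>\<omega>. f \<omega> \<partial>M n) (\<integral>\<omega>. f \<omega> \<partial>N) < e) sequentially"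
      by eventually_elim (auto simp: dist_real_def)
  qed
  with M N show ?thesis unfolding weakly_converges_def by blast
qed

lemma integral_mu_gcd:
  fixes f :: "(int ^ 'd \<Rightarrow> nat) \<Rightarrow> real"
  assumes "finite F" "F \<noteq> {}" "f \<in> borel_measurable borel"
  shows "(\<integral>\<omega>. f \<omega> \<partial>mu_gcd F) = average F (\<lambda>y. f (\<lambda>x. vgcd (x + y)))"
  unfolding mu_gcd_def using assms
  by (simp add: integral_distr integral_pmf_of_set average_def)

theorem proposition2p7:
  fixes F :: "nat \<Rightarrow> (int ^ 'd) set"
  assumes "folner F"
    and "tight_family (\<lambda>n. distr (measure_pmf (pmf_of_set (F n))) (borel :: nat measure) vgcd)"
  shows "CARD('d) \<ge> 2 \<and> weakly_converges (\<lambda>n. mu_gcd (F n)) mu_inf_gcd"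
proof
  show "CARD('d) \<ge> 2" by (rule tight_imp_dim_ge_2[OF assms])
  show "weakly_converges (\<lambda>n. mu_gcd (F n)) mu_inf_gcd"
  proof (rule weakly_convergesI_finite_sites)
    show "prob_space (mu_gcd (F n))" for n
      unfolding mu_gcd_def by (rule measure_pmf.prob_space_distr) simp
    show "sets (mu_gcd (F n)) = sets borel" for n by (simp add: mu_gcd_def)
    show "prob_space (mu_inf_gcd :: (int ^ 'd \<Rightarrow> nat) measure)" by (rule prob_space_mu_inf_gcd)
    show "sets (mu_inf_gcd :: (int ^ 'd \<Rightarrow> nat) measure) = sets borel" by (simp add: mu_inf_gcd_def)
    fix A and f :: "(int ^ 'd \<Rightarrow> nat) \<Rightarrow> real" and B
    assume *: "finite A" "depends_on A f" "\<And>\<omega>. \<bar>f \<omega>\<bar> \<le> B"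
    have "f \<in> borel_measurable borel"
      by (rule borel_measurable_continuous_onI[OF depends_on_continuous[OF *(1,2)]])
    then show "(\<lambda>n. \<integral>\<omega>. f \<omega> \<partial>mu_gcd (F n)) \<longlonglongrightarrow> (\<integral>\<omega>. f \<omega> \<partial>mu_inf_gcd)"
      using averages_tendsto_finite_sites[OF assms *]
      by (simp add: integral_mu_gcd folner_finite[OF assms(1)] folner_nonempty[OF assms(1)])
  qed
qed

end
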